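(* Let $A$ be a C*-algebra and let $B$ be a C*-subalgebra of $A$. If $\mathrm{sep}(B)<1$ then $\mathrm{sep}(B)=0$.
   Context: For $a,b\in A$ write $a\perp b$ if $ab=0=ab^*$, and for $S\subseteq A$ put $S^\perp=\{b\in A:s\perp b\text{ for all }s\in S\}$. An annihilator of $A$ is a set of the form $S^\perp$, $S\subseteq A$; $[A]^\perp$ is the set of annihilators (each is a hereditary C*-subalgebra of $A$). For C*-subalgebras $B,C$ of $A$ let $\|BC\|=\sup\{\|bc\|: b\in B^1_+,\ c\in C^1_+\}$, where $B^1_+$ denotes the set of positive elements of $B$ of norm at most $1$. The separation of $B$ (in $A$) is $$\mathrm{sep}(B)=\inf\{\|BD\|: D\in[A]^\perp,\ D\neq\{0\}\}.$$ *)

theory Defs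
  imports "HOL-Analysis.Analysis"
begin

text \<open>
  C*-algebras are complex, not necessarily unital, and possibly zero. The norm, completeness and
  submultiplicativity come from the superclasses; the real scalar multiplication of the superclasses
  is required to be the restriction of the complex one.
\<close>

class cstar_algebra = real_normed_algebra + banach +
  fixes scaleC :: "complex \<Rightarrow> 'a \<Rightarrow> 'a"  (infixr \<open>*\<^sub>C\<close> 75)
    and adj :: "'a \<Rightarrow> 'a"
  assumes scaleC_add_right: "c *\<^sub>C (x + y) = c *\<^sub>C x + c *\<^sub>C y"
    and scaleC_add_left: "(c + d) *\<^sub>C x = c *\<^sub>C x + d *\<^sub>C x"
    and scaleC_scaleC: "c *\<^sub>C (d *\<^sub>C x) = (c * d) *\<^sub>C x"
    and scaleR_scaleC: "r *\<^sub>R x = complex_of_real r *\<^sub>C x"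
    and mult_scaleC_left: "(c *\<^sub>C x) * y = c *\<^sub>C (x * y)"
    and mult_scaleC_right: "x * (c *\<^sub>C y) = c *\<^sub>C (x * y)"
    and norm_scaleC: "norm (c *\<^sub>C x) = cmod c * norm x"
    and adj_adj: "adj (adj x) = x"
    and adj_add: "adj (x + y) = adj x + adj y"
    and adj_scaleC: "adj (c *\<^sub>C x) = cnj c *\<^sub>C adj x"
    and adj_mult: "adj (x * y) = adj y * adj x"
    and cstar_identity: "norm (adj x * x) = (norm x)\<^sup>2"

definition cstar_subalgebra :: "'a::cstar_algebra set \<Rightarrow> bool" where
  "cstar_subalgebra B \<longleftrightarrow>
     0 \<in> B \<and>
     (\<forall>x\<in>B. \<forall>y\<in>B. x + y \<in> B \<and> x * y \<in> B) \<and>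
     (\<forall>c. \<forall>x\<in>B. c *\<^sub>C x \<in> B) \<and>
     (\<forall>x\<in>B. adj x \<in> B) \<and>
     closed B"

text \<open>
  The pair \<open>(x, c)\<close> stands for the element \<open>x + c 1\<close> of the unitization of the algebra.
  The spectrum is taken in the unitization. If the algebra already has a unit, this only adds the
  point \<open>0\<close> to the spectrum taken in the algebra itself, which is irrelevant for positivity.
\<close>

definition unitization_mult ::
    "'a::cstar_algebra \<times> complex \<Rightarrow> 'a \<times> complex \<Rightarrow> 'a \<times> complex" where
  "unitization_mult p q =
     (fst p * fst q + snd q *\<^sub>C fst p + snd p *\<^sub>C fst q, snd p * snd q)"

definition cstar_spectrum :: "'a::cstar_algebra \<Rightarrow> complex set" where
  "cstar_spectrum a =
     {z. \<not> (\<exists>q. unitization_mult (a, - z) q = (0, 1) \<and> unitization_mult q (a, - z) = (0, 1))}"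

definition cstar_positive :: "'a::cstar_algebra \<Rightarrow> bool" where
  "cstar_positive a \<longleftrightarrow> adj a = a \<and> cstar_spectrum a \<subseteq> complex_of_real ` {0..}"

text \<open>
  Positivity of an element of a C*-subalgebra does not depend on whether it is tested in the
  subalgebra or in the whole algebra, so it is tested in the whole algebra.
\<close>

definition pos_unit_ball :: "'a::cstar_algebra set \<Rightarrow> 'a set" where
  "pos_unit_ball B = {b \<in> B. cstar_positive b \<and> norm b \<le> 1}"

definition cstar_orthogonal :: "'a::cstar_algebra \<Rightarrow> 'a \<Rightarrow> bool" where
  "cstar_orthogonal a b \<longleftrightarrow> a * b = 0 \<and> a * adj b = 0"

definition perp :: "'a::cstar_algebra set \<Rightarrow> 'a set" where
  "perp S = {b. \<forall>s\<in>S. cstar_orthogonal s b}"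

definition annihilators :: "'a::cstar_algebra set set" where
  "annihilators = range perp"

definition prod_norm :: "'a::cstar_algebra set \<Rightarrow> 'a set \<Rightarrow> real" where
  "prod_norm B C = (SUP (b, c) \<in> pos_unit_ball B \<times> pos_unit_ball C. norm (b * c))"

text \<open>
  The infimum is taken in the extended reals, so that it is \<open>\<infinity>\<close> when there is no nonzero annihilator,
  i.e. when the algebra is zero.
\<close>

definition separation :: "'a::cstar_algebra set \<Rightarrow> ereal" where
  "separation B = (INF D \<in> annihilators - {{0}}. ereal (prod_norm B D))"

end

theory Submission
  imports Defs
begin

text \<open>
Call \<open>\<tau>\<close> the norm \<open>\<parallel>B D\<parallel> < 1\<close> for some nonzero annihilator \<open>D\<close>. If \<open>p\<close> denotes the open projection of \<open>B\<close> in
the bidual, then \<open>p\<close> is a supremum of contractions of \<open>B\<close>, and its compression to \<open>D\<close> is at most \<open>\<tau>\<^sup>2\<close>. Choose \<open>b\<close> in \<open>B\<close> and \<open>d\<close> in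
\<open>D\<close> that almost attain the norm. On the part of \<open>D\<close> where \<open>d b\<^sup>2 d\<close> is nearly \<open>\<tau>\<^sup>2\<close>, the element \<open>b\<^sup>2\<close>
exhausts \<open>p\<close> up to a small error. There \<open>sqrt (1 - b\<^sup>2)\<close> removes the component in the range of \<open>p\<close> but, as
\<open>\<tau> < 1\<close>, not the whole vector: it turns that part of \<open>D\<close> into something almost orthogonal to \<open>B\<close>. An
annihilator supported on the result has an arbitrarily small product norm with \<open>B\<close>.

Without the bidual this reads as follows. The lemma \<open>exists_almost_orthogonal\<close> produces an element \<open>x\<close>
with \<open>\<parallel>u x\<parallel>\<close> uniformly small for the self-adjoint contractions \<open>u\<close> of \<open>B\<close>, and with \<open>\<parallel>x\<parallel>\<close> bounded below by a
constant that depends on \<open>\<tau>\<close> only. In place of \<open>p\<close> it uses \<open>b\<^sup>2 + s u\<^sup>2 s\<close> with \<open>s = sqrt (1 - b\<^sup>2)\<close>, a positive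
contraction of \<open>B\<close> that dominates \<open>b\<^sup>2\<close>. The lemma \<open>small_annihilator\<close> passes from \<open>x\<close> to an annihilator by
cutting \<open>x x\<^sup>*\<close> off away from zero.

The functional calculus that this takes is small: square roots, positive and negative parts, and the
powers \<open>Q\<^sup>n\<close> of a nonnegative contraction. It is built in the unitization from one convergent iteration for
the square root (\<open>sqrt_one_minus\<close>), with nonnegative elements described as squares. The theorem of
Kelley and Vaught that \<open>z\<^sup>* z\<close> is nonnegative (\<open>nonneg_adj_mult_self\<close>) is what makes operator
inequalities usable. Squares have nonnegative spectrum, which is the link to the spectral notion of
positivity (\<open>cstar_positive_of_nonneg\<close>).
\<close>

section \<open>Elementary identities\<close>

lemma adj_minus: "adj (- x) = - adj (x::'a::cstar_algebra)"
  by (metis adj_add add_eq_0_iff add.right_neutral add_left_cancel)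

lemma adj_zero [simp]: "adj (0::'a::cstar_algebra) = 0"
  by (metis adj_add add.right_neutral add_left_cancel)

lemma adj_diff: "adj (x - y) = adj x - adj (y::'a::cstar_algebra)"
  by (metis adj_add adj_minus diff_conv_add_uminus)

lemma adj_scaleR: "adj (r *\<^sub>R x) = r *\<^sub>R adj (x::'a::cstar_algebra)"
  by (simp add: scaleR_scaleC adj_scaleC)

lemma norm_adj [simp]: "norm (adj x) = norm (x::'a::cstar_algebra)"
proof -
  have le: "norm y \<le> norm (adj y)" for y :: 'a
  proof (cases "y = 0")
    case False
    have "norm y * norm y \<le> norm (adj y) * norm y"
      by (metis cstar_identity norm_mult_ineq power2_eq_square)
    with False show ?thesis by simp
  qed simp
  show ?thesis
    using le[of x] le[of "adj x"] by (simp add: adj_adj)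
qed

lemma cstar_identity': "norm (x * adj x) = (norm (x::'a::cstar_algebra))\<^sup>2"
  by (metis adj_adj cstar_identity norm_adj)

lemma bounded_linear_adj: "bounded_linear (adj :: 'a::cstar_algebra \<Rightarrow> 'a)"
  by (rule bounded_linear_intro[where K = 1]) (simp_all add: adj_add adj_scaleR)

class cstar_algebra_1 = cstar_algebra + real_normed_algebra_1

lemma adj_one [simp]: "adj (1::'a::cstar_algebra_1) = 1"
  by (metis adj_adj adj_mult mult.right_neutral mult.left_neutral)

lemma adj_power: "adj (x ^ n) = adj (x::'a::cstar_algebra_1) ^ n"
  by (induction n) (simp_all add: adj_mult power_commutes)

lemma norm_selfadjoint_square:
  "adj h = h \<Longrightarrow> norm (h * h) = (norm (h::'a::cstar_algebra))\<^sup>2"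
  by (metis cstar_identity)

section \<open>Square roots\<close>

definition closed_subalgebra :: "'a::cstar_algebra set \<Rightarrow> bool" where
  "closed_subalgebra J \<longleftrightarrow> subspace J \<and> (\<forall>x\<in>J. \<forall>y\<in>J. x * y \<in> J) \<and> closed J"

text \<open>
Multipliers accommodate functions of an element that do not vanish at zero: the multiplier set is a closed subalgebra that contains the unit as well as \<open>J\<close>, and it multiplies \<open>J\<close> into \<open>J\<close>.
\<close>

definition multipliers :: "'a::cstar_algebra set \<Rightarrow> 'a set" where
  "multipliers J = {z. \<forall>x\<in>J. z * x \<in> J \<and> x * z \<in> J}"

lemma closed_subalgebra_multipliers:
  assumes "closed_subalgebra J"
  shows "closed_subalgebra (multipliers J)"
proof -
  have J: "subspace J" "\<And>x y. x \<in> J \<Longrightarrow> y \<in> J \<Longrightarrow> x * y \<in> J" "closed J"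
    using assms by (auto simp: closed_subalgebra_def)
  have "multipliers J = (\<Inter>x\<in>J. (\<lambda>z. z * x) -` J \<inter> (\<lambda>z. x * z) -` J)"
    by (auto simp: multipliers_def)
  moreover have "closed ((\<lambda>z. z * x) -` J)" "closed ((\<lambda>z. x * z) -` J)" for x
    by (intro closed_vimage J continuous_intros)+
  ultimately have "closed (multipliers J)" by (auto intro!: closed_Int)
  moreover have "subspace (multipliers J)"
    using J(1) by (auto simp: subspace_def multipliers_def algebra_simps)
  moreover have "x * y \<in> multipliers J" if "x \<in> multipliers J" "y \<in> multipliers J" for x y
    using that unfolding multipliers_def by simp (metis mult.assoc)
  ultimately show ?thesis by (simp add: closed_subalgebra_def)
qed

lemma subset_multipliers: "closed_subalgebra J \<Longrightarrow> J \<subseteq> multipliers J"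
  by (auto simp: closed_subalgebra_def multipliers_def)

lemma one_in_multipliers: "(1::'a::cstar_algebra_1) \<in> multipliers J"
  by (simp add: multipliers_def)

text \<open>
Writing \<open>s = 1 - y\<close>, the equation \<open>s\<^sup>2 = 1 - k\<close> becomes the fixed point equation \<open>y = (k + y\<^sup>2) / 2\<close>, which is
solved by iteration from \<open>0\<close>. When \<open>k\<close> has norm \<open>1\<close> the map need not be a strict contraction. The
increments are instead dominated by those of the same iteration for the number \<open>k = 1\<close>, which
increases to \<open>1\<close>, so they are summable. Everything that the iterates inherit from \<open>k\<close> passes to the
limit.
\<close>

lemma sqrt_one_minus:
  fixes k :: "'a::cstar_algebra_1"
  assumes sa: "adj k = k" and nk: "norm k \<le> 1"
  shows "\<exists>s. adj s = s \<and> s * s = 1 - k \<and> norm (1 - s) \<le> 1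
    \<and> (\<forall>c. c * k = k * c \<longrightarrow> c * s = s * c)
    \<and> (\<forall>J. closed_subalgebra J \<longrightarrow> 1 \<in> J \<longrightarrow> k \<in> J \<longrightarrow> s \<in> J)"
proof -
  define y where "y = rec_nat 0 (\<lambda>_ z. (1/2) *\<^sub>R (k + z * z))"
  define \<rho> where "\<rho> = rec_nat (0::real) (\<lambda>_ z. (1 + z * z) / 2)"
  have y0: "y 0 = 0" and yS: "\<And>n. y (Suc n) = (1/2) *\<^sub>R (k + y n * y n)"
    by (simp_all add: y_def)
  have r0: "\<rho> 0 = 0" and rS: "\<And>n. \<rho> (Suc n) = (1 + \<rho> n * \<rho> n) / 2"
    by (simp_all add: \<rho>_def)
  have r01: "0 \<le> \<rho> n \<and> \<rho> n \<le> 1" for n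
    by (induction n) (simp_all add: r0 rS mult_le_one)
  have ny: "norm (y n) \<le> \<rho> n" for n
  proof (induction n)
    case (Suc n)
    have "norm (y n * y n) \<le> \<rho> n * \<rho> n"
      using Suc r01[of n] by (intro order_trans[OF norm_mult_ineq] mult_mono) auto
    with nk have "norm (k + y n * y n) \<le> 1 + \<rho> n * \<rho> n"
      by (intro norm_triangle_le) simp
    then show ?case by (simp add: yS rS)
  qed (simp add: y0 r0)
  have comm: "c * y n = y n * c" if "c * k = k * c" for c n
  proof (induction n)
    case (Suc n)
    have "c * (y n * y n) = (y n * y n) * c" using Suc by (metis mult.assoc)
    with that show ?case by (simp add: yS algebra_simps)
  qed (simp add: y0)
  have yy: "y m * y n = y n * y m" for m n
    using comm[OF comm[OF refl, symmetric]] by simp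
  have step: "norm (y (Suc n) - y n) \<le> \<rho> (Suc n) - \<rho> n" for n
  proof (induction n)
    case 0
    show ?case using nk by (simp add: y0 yS r0 rS)
  next
    case (Suc n)
    have "y (Suc (Suc n)) - y (Suc n) = (1/2) *\<^sub>R ((y (Suc n) - y n) * (y (Suc n) + y n))"
      unfolding yS[of "Suc n"] yS[of n, symmetric] using yy[of n "Suc n"]
      by (subst (3) yS) (simp add: algebra_simps)
    then have "norm (y (Suc (Suc n)) - y (Suc n))
        \<le> (1/2) * (norm (y (Suc n) - y n) * norm (y (Suc n) + y n))"
      using norm_mult_ineq by simp
    also have "\<dots> \<le> (1/2) * ((\<rho> (Suc n) - \<rho> n) * (\<rho> (Suc n) + \<rho> n))"
      using Suc ny[of n] ny[of "Suc n"] r01[of n] r01[of "Suc n"]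
        order_trans[OF norm_ge_zero Suc]
      by (intro mult_left_mono mult_mono norm_triangle_le)
         (auto intro: order_trans[OF norm_ge_zero])
    also have "\<dots> = \<rho> (Suc (Suc n)) - \<rho> (Suc n)"
      unfolding rS[of "Suc n"] by (subst (4) rS) (simp add: field_simps)
    finally show ?case .
  qed
  have "summable (\<lambda>n. \<rho> (Suc n) - \<rho> n)"
  proof (rule summableI_nonneg_bounded[where x = 1])
    show "0 \<le> \<rho> (Suc n) - \<rho> n" for n using step[of n] norm_ge_zero order_trans by blast
    show "(\<Sum>i<n. \<rho> (Suc i) - \<rho> i) \<le> 1" for n
      using r01[of n] by (simp add: sum_lessThan_telescope r0)
  qed
  then have "summable (\<lambda>n. y (Suc n) - y n)"
    by (rule summable_comparison_test'[where N = 0]) (use step in auto)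
  then have "convergent (\<lambda>n. \<Sum>i<n. y (Suc i) - y i)"
    by (simp add: summable_iff_convergent)
  then obtain L where L: "y \<longlonglongrightarrow> L"
    by (auto simp: sum_lessThan_telescope y0 convergent_def)
  have "(\<lambda>n. (1/2) *\<^sub>R (k + y n * y n)) \<longlonglongrightarrow> (1/2) *\<^sub>R (k + L * L)"
    by (intro tendsto_intros L)
  moreover have "(\<lambda>n. y (Suc n)) \<longlonglongrightarrow> L" using L by (rule LIMSEQ_Suc)
  ultimately have LL: "L = (1/2) *\<^sub>R (k + L * L)"
    unfolding yS by (rule LIMSEQ_unique[symmetric])
  then have "2 *\<^sub>R L = k + L * L"
    by (metis scaleR_half_double scaleR_2 scaleR_scaleR mult_2 field_sum_of_halves
        scaleR_left_distrib scaleR_one)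
  then have sq: "(1 - L) * (1 - L) = 1 - k"
    by (simp add: algebra_simps scaleR_2)
  have adjy: "adj (y n) = y n" for n
    by (induction n) (simp_all add: y0 yS adj_scaleR adj_add adj_mult sa)
  have "(\<lambda>n. adj (y n)) \<longlonglongrightarrow> adj L"
    by (rule bounded_linear.tendsto[OF bounded_linear_adj L])
  then have aL: "adj L = L" using L by (simp add: adjy LIMSEQ_unique)
  have nL: "norm L \<le> 1"
    by (rule Lim_norm_ubound[OF _ L])
       (simp, rule always_eventually, rule allI, rule order_trans[OF ny], simp add: r01)
  have Lc: "c * L = L * c" if "c * k = k * c" for c
  proof -
    have "(\<lambda>n. c * y n) \<longlonglongrightarrow> c * L" "(\<lambda>n. y n * c) \<longlonglongrightarrow> L * c"
      by (intro tendsto_intros L)+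
    then show ?thesis by (simp add: comm[OF that] LIMSEQ_unique)
  qed
  have JL: "1 - L \<in> J" if "closed_subalgebra J" "1 \<in> J" "k \<in> J" for J
  proof -
    have J: "subspace J" "\<And>x y. x \<in> J \<Longrightarrow> y \<in> J \<Longrightarrow> x * y \<in> J" "closed J"
      using that by (auto simp: closed_subalgebra_def)
    have "y n \<in> J" for n
      by (induction n)
         (auto simp: y0 yS subspace_0 J intro!: subspace_scale subspace_add that(3))
    then have "L \<in> J" using L J(3) closed_sequentially by blast
    with J that show ?thesis by (simp add: subspace_diff)
  qed
  have cL: "c * (1 - L) = (1 - L) * c" if "c * k = k * c" for c
    using Lc[OF that] by (simp add: algebra_simps)
  show ?thesis
  proof (intro exI[of _ "1 - L"] conjI allI impI)
    show "adj (1 - L) = 1 - L" using aL by (simp add: adj_diff)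
    show "norm (1 - (1 - L)) \<le> 1" using nL by simp
  qed (fact sq cL JL)+
qed

section \<open>Nonnegative elements\<close>

lemma scaleC_minus_left: "(- c) *\<^sub>C (x::'a::cstar_algebra) = - (c *\<^sub>C x)"
proof -
  have "(0::complex) *\<^sub>C x = 0" using scaleR_scaleC[of 0 x] by simp
  then have "c *\<^sub>C x + (- c) *\<^sub>C x = 0" by (metis add.right_inverse scaleC_add_left)
  then show ?thesis by (metis minus_unique)
qed

text \<open>
In a unital algebra this is the usual order: the squares of self-adjoint elements are the
self-adjoint elements with spectrum in the nonnegative reals. The description by squares, together
with its equivalent \<open>\<parallel>C 1 - a\<parallel> \<le> C\<close> (\<open>nonneg_norm_diff_le\<close> and \<open>nonnegI\<close>), gives the order
structure without spectra.
\<close>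

definition nonneg :: "'a::cstar_algebra \<Rightarrow> bool" where
  "nonneg a \<longleftrightarrow> (\<exists>h. adj h = h \<and> a = h * h)"

lemma nonneg_square: "adj h = h \<Longrightarrow> nonneg (h * h)"
  by (auto simp: nonneg_def)

lemma nonneg_adj: "nonneg a \<Longrightarrow> adj a = a"
  by (auto simp: nonneg_def adj_mult)

lemma nonneg_zero [simp]: "nonneg 0"
  unfolding nonneg_def by (rule exI[of _ 0]) simp

lemma nonneg_one [simp]: "nonneg (1::'a::cstar_algebra_1)"
  unfolding nonneg_def by (rule exI[of _ 1]) simp

lemma nonneg_scaleR:
  assumes "nonneg a" "0 \<le> r"
  shows "nonneg (r *\<^sub>R a)"
proof -
  obtain h where "adj h = h" "a = h * h" using assms by (auto simp: nonneg_def)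
  then have "adj (sqrt r *\<^sub>R h) = sqrt r *\<^sub>R h" "r *\<^sub>R a = (sqrt r *\<^sub>R h) * (sqrt r *\<^sub>R h)"
    using assms(2) by (simp_all add: adj_scaleR)
  then show ?thesis by (metis nonneg_square)
qed

text \<open>
The element \<open>h + \<i> q\<close> is an isometry and \<open>h\<close> is its real part.
\<close>

lemma norm_le_one_of_squares_sum_one:
  fixes h q :: "'a::cstar_algebra_1"
  assumes "adj h = h" "adj q = q" "h * q = q * h" "h * h + q * q = 1"
  shows "norm h \<le> 1"
proof -
  define v where "v = \<i> *\<^sub>C q"
  have av: "adj (h + v) = h - v"
    by (simp add: v_def adj_add adj_scaleC assms scaleC_minus_left)
  have "h * v = v * h" "v * v = - (q * q)"
    using scaleR_scaleC[of "-1" "q * q"]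
    by (simp_all add: v_def mult_scaleC_left mult_scaleC_right scaleC_scaleC assms)
  then have "adj (h + v) * (h + v) = 1"
    unfolding av using assms(4) by (simp add: algebra_simps)
  then have "norm (h + v) = 1"
    by (metis cstar_identity norm_one norm_ge_zero power2_eq_1_iff
        le_minus_one_simps(3) zero_neq_neg_one)
  moreover have "2 *\<^sub>R h = (h + v) + adj (h + v)"
    unfolding av by (simp add: scaleR_2)
  then have "2 * norm h \<le> norm (h + v) + norm (adj (h + v))"
    by (metis norm_triangle_ineq norm_scaleR abs_numeral)
  ultimately show ?thesis by simp
qed

text \<open>
After rescaling, \<open>a = h\<^sup>2\<close> with \<open>h\<close> a contraction, and \<open>1 - h\<^sup>2 = s\<^sup>2\<close> where \<open>h\<^sup>2 + s\<^sup>2 = 1\<close> makes \<open>s\<close> a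
contraction as well.
\<close>

lemma nonneg_norm_diff_le:
  fixes a :: "'a::cstar_algebra_1"
  assumes "nonneg a" "norm a \<le> C"
  shows "norm (C *\<^sub>R 1 - a) \<le> C"
proof (cases "C = 0")
  case False
  with assms have C: "C > 0" using norm_ge_zero[of a] by linarith
  have "nonneg ((1 / C) *\<^sub>R a)" using assms C by (intro nonneg_scaleR) auto
  then obtain h where h: "adj h = h" "(1 / C) *\<^sub>R a = h * h" by (auto simp: nonneg_def)
  have "norm (h * h) \<le> 1" unfolding h(2)[symmetric] using assms C by simp
  moreover have "adj (h * h) = h * h" by (simp add: adj_mult h)
  ultimately obtain s where s: "adj s = s" "s * s = 1 - h * h"
    and sc: "\<forall>c. c * (h * h) = (h * h) * c \<longrightarrow> c * s = s * c"
    using sqrt_one_minus[of "h * h"] by blast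
  have hs: "h * s = s * h" using sc by (simp add: mult.assoc)
  have "norm s \<le> 1"
    by (rule norm_le_one_of_squares_sum_one[of s h]) (simp_all add: h s hs)
  then have "norm (s * s) \<le> 1"
    unfolding norm_selfadjoint_square[OF s(1)] by (simp add: power_le_one)
  moreover have "C *\<^sub>R 1 - a = C *\<^sub>R (s * s)"
    unfolding s h(2)[symmetric] using C by (simp add: algebra_simps)
  ultimately show ?thesis using C by simp
qed (use assms in simp)

text \<open>
The root comes as a limit of polynomials in \<open>w\<close> that do not vanish at zero, hence at first only as
a multiplier of the subalgebras that contain \<open>w\<close>; \<open>exists_nonneg_sqrt\<close> places it inside them.
\<close>

lemma exists_sqrt:
  fixes w :: "'a::cstar_algebra_1"
  assumes w: "adj w = w" "norm (C *\<^sub>R 1 - w) \<le> C"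
  shows "\<exists>r. adj r = r \<and> norm (sqrt C *\<^sub>R 1 - r) \<le> sqrt C \<and> r * r = w
    \<and> (\<forall>c. c * w = w * c \<longrightarrow> c * r = r * c)
    \<and> (\<forall>J. closed_subalgebra J \<longrightarrow> w \<in> J \<longrightarrow> r \<in> multipliers J)"
proof (cases "C \<le> 0")
  case True
  have "0 \<le> norm (C *\<^sub>R 1 - w)" by simp
  with True w(2) have "C = 0" by linarith
  with w(2) show ?thesis
    by (intro exI[of _ 0]) (auto simp: multipliers_def closed_subalgebra_def subspace_0)
next
  case False
  then have C: "C > 0" by simp
  define k where "k = 1 - (1 / C) *\<^sub>R w"
  have "k = (1 / C) *\<^sub>R (C *\<^sub>R 1 - w)" using C by (simp add: k_def algebra_simps)
  then have "norm k \<le> 1" using w C by simp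
  moreover have "adj k = k" by (simp add: k_def adj_diff adj_scaleR w)
  ultimately obtain s where s: "adj s = s" "s * s = 1 - k" "norm (1 - s) \<le> 1"
    and sc: "\<forall>c. c * k = k * c \<longrightarrow> c * s = s * c"
    and sJ: "\<forall>J. closed_subalgebra J \<longrightarrow> 1 \<in> J \<longrightarrow> k \<in> J \<longrightarrow> s \<in> J"
    using sqrt_one_minus[of k] by blast
  show ?thesis
  proof (intro exI[of _ "sqrt C *\<^sub>R s"] conjI allI impI)
    show "adj (sqrt C *\<^sub>R s) = sqrt C *\<^sub>R s" by (simp add: adj_scaleR s)
    have "sqrt C *\<^sub>R 1 - sqrt C *\<^sub>R s = sqrt C *\<^sub>R (1 - s)" by (simp add: algebra_simps)
    then show "norm (sqrt C *\<^sub>R 1 - sqrt C *\<^sub>R s) \<le> sqrt C"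
      using s(3) C by (simp add: mult_left_le)
    show "sqrt C *\<^sub>R s * sqrt C *\<^sub>R s = w" using C by (simp add: s k_def)
    show "c * sqrt C *\<^sub>R s = sqrt C *\<^sub>R s * c" if "c * w = w * c" for c
    proof -
      have "c * k = k * c" using that by (simp add: k_def algebra_simps)
      with sc have "c * s = s * c" by blast
      then show ?thesis by simp
    qed
    show "sqrt C *\<^sub>R s \<in> multipliers J" if J: "closed_subalgebra J" "w \<in> J" for J
    proof -
      note M = closed_subalgebra_multipliers[OF J(1)]
      have sub: "subspace (multipliers J)" using M by (simp add: closed_subalgebra_def)
      have "k \<in> multipliers J" unfolding k_def
        using sub one_in_multipliers subset_multipliers[OF J(1)] J(2)
        by (intro subspace_diff subspace_scale) auto
      then have "s \<in> multipliers J" using sJ M one_in_multipliers by blast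
      then show ?thesis by (intro subspace_scale sub)
    qed
  qed
qed

lemma nonnegI:
  fixes a :: "'a::cstar_algebra_1"
  assumes "adj a = a" "norm (C *\<^sub>R 1 - a) \<le> C"
  shows "nonneg a"
  unfolding nonneg_def using exists_sqrt[OF assms] by metis

lemma nonneg_diff_of_norm_le:
  fixes a :: "'a::cstar_algebra_1"
  assumes "adj a = a" "norm a \<le> C"
  shows "nonneg (C *\<^sub>R 1 - a)"
  by (rule nonnegI[where C = C]) (use assms in \<open>simp_all add: adj_diff adj_scaleR\<close>)

lemma exists_nonneg_sqrt_multiplier:
  fixes w :: "'a::cstar_algebra_1"
  assumes "nonneg w"
  shows "\<exists>r. nonneg r \<and> r * r = w \<and> (\<forall>c. c * w = w * c \<longrightarrow> c * r = r * c)
    \<and> (\<forall>J. closed_subalgebra J \<longrightarrow> w \<in> J \<longrightarrow> r \<in> multipliers J)"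
  using exists_sqrt[OF nonneg_adj[OF assms] nonneg_norm_diff_le[OF assms order_refl]] nonnegI
  by blast

text \<open>
The bound \<open>\<parallel>C 1 - a\<parallel> \<le> C\<close> is additive in the pair \<open>(C, a)\<close>.
\<close>

lemma nonneg_add:
  fixes a b :: "'a::cstar_algebra_1"
  assumes "nonneg a" "nonneg b"
  shows "nonneg (a + b)"
proof (rule nonnegI[where C = "norm a + norm b"])
  show "adj (a + b) = a + b" using assms by (simp add: adj_add nonneg_adj)
  have "(norm a + norm b) *\<^sub>R 1 - (a + b) = (norm a *\<^sub>R 1 - a) + (norm b *\<^sub>R 1 - b)"
    by (simp add: scaleR_add_left)
  then show "norm ((norm a + norm b) *\<^sub>R 1 - (a + b)) \<le> norm a + norm b"
    using nonneg_norm_diff_le[OF assms(1) order_refl] nonneg_norm_diff_le[OF assms(2) order_refl]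
    by (simp only: norm_triangle_mono)
qed

lemma nonneg_mult:
  fixes a b :: "'a::cstar_algebra_1"
  assumes "nonneg a" "nonneg b" "a * b = b * a"
  shows "nonneg (a * b)"
proof -
  obtain h where h: "nonneg h" "h * h = a" "\<forall>c. c * a = a * c \<longrightarrow> c * h = h * c"
    using exists_nonneg_sqrt_multiplier[OF assms(1)] by blast
  obtain k where k: "nonneg k" "k * k = b" "\<forall>c. c * b = b * c \<longrightarrow> c * k = k * c"
    using exists_nonneg_sqrt_multiplier[OF assms(2)] by blast
  have "b * h = h * b" using h(3) assms(3) by simp
  then have hk: "h * k = k * h" using k(3) by simp
  have "a * b = (h * k) * (h * k)"
    unfolding h(2)[symmetric] k(2)[symmetric] by (metis hk mult.assoc)
  moreover have "adj (h * k) = h * k"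
    using h(1) k(1) hk by (simp add: adj_mult nonneg_adj)
  ultimately show ?thesis by (metis nonneg_square)
qed

lemma nonneg_power:
  fixes a :: "'a::cstar_algebra_1"
  shows "nonneg a \<Longrightarrow> nonneg (a ^ n)"
  by (induction n) (simp_all add: nonneg_mult power_commutes)

lemma nonneg_sum:
  fixes f :: "'b \<Rightarrow> 'a::cstar_algebra_1"
  shows "(\<And>i. i \<in> I \<Longrightarrow> nonneg (f i)) \<Longrightarrow> nonneg (sum f I)"
  by (induction I rule: infinite_finite_induct) (auto simp: nonneg_add)

lemma nonneg_lim:
  fixes a :: "nat \<Rightarrow> 'a::cstar_algebra_1"
  assumes "\<And>n. nonneg (a n)" "a \<longlonglongrightarrow> l"
  shows "nonneg l"
proof -
  obtain C where C: "\<And>n. norm (a n) \<le> C"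
    using assms(2) convergentI convergent_imp_Bseq Bseq_def by metis
  have "(\<lambda>n. C *\<^sub>R 1 - a n) \<longlonglongrightarrow> C *\<^sub>R 1 - l" by (intro tendsto_intros assms)
  then have "norm (C *\<^sub>R 1 - l) \<le> C"
    by (rule Lim_norm_ubound[rotated]) (simp_all add: nonneg_norm_diff_le assms C)
  moreover have "(\<lambda>n. adj (a n)) \<longlonglongrightarrow> adj l"
    by (rule bounded_linear.tendsto[OF bounded_linear_adj assms(2)])
  then have "adj l = l" using assms by (simp add: nonneg_adj LIMSEQ_unique)
  ultimately show ?thesis by (rule nonnegI[rotated])
qed

text \<open>
From \<open>C\<^sup>2 - a\<^sup>2 = (C - a) (C + a) \<ge> 0\<close> one gets a self-adjoint \<open>q\<close> with \<open>(a / C)\<^sup>2 + q\<^sup>2 = 1\<close>.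
\<close>

lemma norm_le_of_nonneg_diff:
  fixes a :: "'a::cstar_algebra_1"
  assumes a: "nonneg a" and Ca: "nonneg (C *\<^sub>R 1 - a)" and "0 < C"
  shows "norm a \<le> C"
proof -
  have "nonneg (C *\<^sub>R 1 + a)" using assms by (intro nonneg_add nonneg_scaleR) auto
  with Ca have "nonneg ((C *\<^sub>R 1 - a) * (C *\<^sub>R 1 + a))"
    by (rule nonneg_mult) (simp add: algebra_simps)
  then have "nonneg ((1 / C\<^sup>2) *\<^sub>R ((C *\<^sub>R 1 - a) * (C *\<^sub>R 1 + a)))"
    by (intro nonneg_scaleR) auto
  moreover define h where "h = (1 / C) *\<^sub>R a"
  have "(1 / C\<^sup>2) *\<^sub>R ((C *\<^sub>R 1 - a) * (C *\<^sub>R 1 + a)) = 1 - h * h"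
    using \<open>0 < C\<close> by (simp add: h_def algebra_simps power2_eq_square)
  ultimately have "nonneg (1 - h * h)" by simp
  then obtain q where q: "nonneg q" "q * q = 1 - h * h"
    and qc: "\<forall>c. c * (1 - h * h) = (1 - h * h) * c \<longrightarrow> c * q = q * c"
    using exists_nonneg_sqrt_multiplier by blast
  have hq: "h * q = q * h" using qc by (simp add: algebra_simps)
  have "adj h = h" using a by (simp add: h_def adj_scaleR nonneg_adj)
  then have "norm h \<le> 1"
    using q hq by (intro norm_le_one_of_squares_sum_one[of h q]) (simp_all add: nonneg_adj)
  then show ?thesis using \<open>0 < C\<close> by (simp add: h_def)
qed

lemma norm_mono:
  fixes a b :: "'a::cstar_algebra_1"
  assumes "nonneg a" "nonneg (b - a)"
  shows "norm a \<le> norm b"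
proof (rule field_le_epsilon)
  fix e :: real assume "e > 0"
  have "nonneg b" using nonneg_add[OF assms] by simp
  then have "nonneg ((norm b + e) *\<^sub>R 1 - b)"
    using \<open>e > 0\<close> by (intro nonneg_diff_of_norm_le) (auto simp: nonneg_adj)
  from nonneg_add[OF this assms(2)] show "norm a \<le> norm b + e"
    using \<open>e > 0\<close> by (intro norm_le_of_nonneg_diff assms) (auto simp: add_nonneg_pos)
qed

text \<open>
With real and imaginary parts, \<open>y\<^sup>* y + y y\<^sup>*\<close> is a sum of two squares, so \<open>y\<^sup>* y \<le> 0\<close> forces \<open>P = y y\<^sup>* \<ge> 0\<close>.
Let \<open>M = \<parallel>P\<parallel> = \<parallel>y\<^sup>* y\<parallel>\<close>. Because \<open>y\<^sup>* y\<close> is nonpositive, \<open>\<parallel>M + y\<^sup>* y\<parallel> \<le> M\<close>, and compressing by \<open>y\<close>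
gives \<open>\<parallel>M P + P\<^sup>2\<parallel> \<le> M\<^sup>2\<close>. But for a nonnegative \<open>P\<close> of norm \<open>M\<close> that norm is \<open>2 M\<^sup>2\<close>. That it
exceeds \<open>M\<^sup>2\<close> is seen on \<open>Q = P / M\<close>: from \<open>Q + Q\<^sup>2 \<le> 1\<close> and \<open>Q\<^sup>2 \<le> Q\<close> follows \<open>2 Q\<^sup>2 \<le> 1\<close>, contrary to \<open>\<parallel>Q\<^sup>2\<parallel> = 1\<close>.
\<close>

lemma zero_of_adj_mult_nonpos:
  fixes y :: "'a::cstar_algebra_1"
  assumes neg: "nonneg (- (adj y * y))"
  shows "y = 0"
proof (rule ccontr)
  assume "y \<noteq> 0"
  define M where "M = (norm y)\<^sup>2"
  have M: "M > 0" using \<open>y \<noteq> 0\<close> by (simp add: M_def)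
  define P where "P = y * adj y"
  have nP: "norm P = M" by (simp add: P_def M_def cstar_identity')
  define p where "p = y + adj y"
  define d where "d = \<i> *\<^sub>C (y - adj y)"
  have "adj d = d"
  proof -
    have "adj d = - (\<i> *\<^sub>C (adj y - y))"
      by (simp add: d_def adj_scaleC adj_diff adj_adj scaleC_minus_left)
    also have "\<dots> = (-1) *\<^sub>R (\<i> *\<^sub>C (adj y - y))" by simp
    also have "\<dots> = \<i> *\<^sub>C ((-1) *\<^sub>R (adj y - y))"
      unfolding scaleR_scaleC scaleC_scaleC by (simp add: mult.commute)
    finally show ?thesis by (simp add: d_def)
  qed
  moreover have "adj p = p" by (simp add: p_def adj_add adj_adj add.commute)
  ultimately have "nonneg ((1/2) *\<^sub>R (p * p + d * d) + - (adj y * y))"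
    by (intro nonneg_add nonneg_scaleR nonneg_square neg) auto
  moreover have "d * d = - ((y - adj y) * (y - adj y))"
    using scaleR_scaleC[of "-1" "(y - adj y) * (y - adj y)"]
    by (simp add: d_def mult_scaleC_left mult_scaleC_right scaleC_scaleC)
  then have "p * p + d * d = 2 *\<^sub>R (P + adj y * y)"
    by (simp add: p_def P_def algebra_simps scaleR_2)
  ultimately have P: "nonneg P" by simp
  have "norm (M *\<^sub>R 1 - - (adj y * y)) \<le> M"
    using neg by (rule nonneg_norm_diff_le) (simp add: cstar_identity M_def)
  then have "norm (y * (M *\<^sub>R 1 - - (adj y * y)) * adj y) \<le> norm y * M * norm (adj y)"
    by (intro order_trans[OF norm_mult_ineq] mult_right_mono mult_left_mono) auto
  also have "y * (M *\<^sub>R 1 - - (adj y * y)) * adj y = M *\<^sub>R P + P * P"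
    by (simp add: P_def algebra_simps)
  also have "norm y * M * norm (adj y) = M * M"
    by (simp add: M_def power2_eq_square mult_ac)
  finally have bound: "norm (M *\<^sub>R P + P * P) \<le> M * M" .
  define Q where "Q = (1 / M) *\<^sub>R P"
  have Q: "nonneg Q" unfolding Q_def using P M by (intro nonneg_scaleR) auto
  have nQ: "norm Q = 1" using nP M by (simp add: Q_def)
  have "Q + Q * Q = (1 / (M * M)) *\<^sub>R (M *\<^sub>R P + P * P)"
    using M by (simp add: Q_def algebra_simps)
  then have "norm (Q + Q * Q) \<le> 1"
    using bound M by (simp add: divide_le_eq)
  then have 1: "nonneg (1 *\<^sub>R 1 - (Q + Q * Q))"
    using Q by (intro nonneg_diff_of_norm_le) (auto simp: adj_add adj_mult nonneg_adj)
  have "nonneg (1 *\<^sub>R 1 - Q)"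
    using Q nQ by (intro nonneg_diff_of_norm_le) (auto simp: nonneg_adj)
  then have "nonneg (Q * (1 *\<^sub>R 1 - Q))"
    by (intro nonneg_mult Q) (auto simp: algebra_simps)
  from nonneg_add[OF 1 this] have "nonneg (1 *\<^sub>R 1 - 2 *\<^sub>R (Q * Q))"
    by (simp add: algebra_simps scaleR_2)
  then have "norm (2 *\<^sub>R (Q * Q)) \<le> 1"
    using Q by (intro norm_le_of_nonneg_diff nonneg_scaleR nonneg_square) (auto simp: nonneg_adj)
  then show False
    using norm_selfadjoint_square[of Q] Q nQ by (simp add: nonneg_adj)
qed

text \<open>
The argument of Kelley and Vaught. With \<open>h = z\<^sup>* z\<close>, \<open>r = \<bar>h\<bar>\<close> and \<open>n = r - h\<close>, twice the negative part of
\<open>h\<close>, one has \<open>(z n)\<^sup>* (z n) = n h n = - n r n \<le> 0\<close>. Hence \<open>z n = 0\<close>, which leads to \<open>n = 0\<close> and \<open>h = r\<close>.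
\<close>

lemma nonneg_adj_mult_self:
  fixes z :: "'a::cstar_algebra_1"
  shows "nonneg (adj z * z)"
proof -
  define h where "h = adj z * z"
  have h: "adj h = h" by (simp add: h_def adj_mult adj_adj)
  obtain r where r: "nonneg r" "r * r = h * h" "\<forall>c. c * (h * h) = (h * h) * c \<longrightarrow> c * r = r * c"
    using exists_nonneg_sqrt_multiplier[OF nonneg_square[OF h]] by blast
  obtain f where f: "nonneg f" "f * f = r" "\<forall>c. c * r = r * c \<longrightarrow> c * f = f * c"
    using exists_nonneg_sqrt_multiplier[OF r(1)] by blast
  define n where "n = r - h"
  have hr: "h * r = r * h" using r(3) by (simp add: mult.assoc)
  have n: "adj n = n" using r(1) h by (simp add: n_def adj_diff nonneg_adj)
  have hn: "h * n = - (r * n)" using r(2) hr by (simp add: n_def algebra_simps)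
  have nf: "n * f = f * n" using f(3)[rule_format, of n] hr by (simp add: n_def algebra_simps)
  have "adj (z * n) * (z * n) = n * (h * n)"
    by (simp add: adj_mult n h_def mult.assoc)
  also have "n * (h * n) = - ((n * f) * (f * n))"
    unfolding hn f(2)[symmetric] by (simp add: mult.assoc)
  also have "\<dots> = - ((n * f) * (n * f))" by (simp only: nf)
  finally have sq: "adj (z * n) * (z * n) = - ((n * f) * (n * f))" .
  moreover have "adj (n * f) = n * f" using f(1) n nf by (simp add: adj_mult nonneg_adj)
  ultimately have "z * n = 0"
    by (intro zero_of_adj_mult_nonpos) (auto intro: nonneg_square)
  then have "h * n = 0" by (simp add: h_def mult.assoc)
  then have "r * n = 0" using hn by simp
  then have "n * n = 0" using \<open>h * n = 0\<close> by (simp add: n_def left_diff_distrib)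
  then have "n = 0" using norm_selfadjoint_square[OF n] by simp
  then show ?thesis using r(1) by (simp add: n_def h_def)
qed

lemma nonneg_self_mult_adj: "nonneg (z * adj (z::'a::cstar_algebra_1))"
  using nonneg_adj_mult_self[of "adj z"] by (simp add: adj_adj)

lemma nonneg_conj:
  fixes z :: "'a::cstar_algebra_1"
  assumes "nonneg a"
  shows "nonneg (adj z * a * z)"
proof -
  obtain h where "adj h = h" "a = h * h" using assms by (auto simp: nonneg_def)
  then have "adj z * a * z = adj (h * z) * (h * z)" by (simp add: adj_mult mult.assoc)
  then show ?thesis using nonneg_adj_mult_self by metis
qed

lemma nonneg_one_minus:
  fixes Q :: "'a::cstar_algebra_1"
  shows "adj Q = Q \<Longrightarrow> norm Q \<le> 1 \<Longrightarrow> nonneg (1 - Q)"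
  using nonneg_diff_of_norm_le[of Q 1] by simp

text \<open>
The powers of \<open>Q\<close> decrease, so \<open>(n + 1) Q\<^sup>n (1 - Q)\<close> is below the telescoping sum
\<open>\<Sum>i\<le>n. Q\<^sup>i (1 - Q) = 1 - Q\<^bsup>n + 1\<^esup>\<close>.
\<close>

lemma norm_power_mult_one_minus_le:
  fixes Q :: "'a::cstar_algebra_1"
  assumes Q: "nonneg Q" "norm Q \<le> 1"
  shows "norm (Q ^ n * (1 - Q)) \<le> 1 / (real n + 1)"
proof -
  have Q1: "nonneg (1 - Q)" using Q by (simp add: nonneg_one_minus nonneg_adj)
  have comm: "Q ^ n * Q = Q * Q ^ n" for n by (simp add: power_commutes)
  have pos: "nonneg (Q ^ n * (1 - Q))" for n
    by (intro nonneg_mult nonneg_power Q Q1) (simp add: algebra_simps comm)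
  have T: "nonneg (1 - Q ^ Suc n - (real n + 1) *\<^sub>R (Q ^ n * (1 - Q)))" for n
  proof (induction n)
    case (Suc n)
    have "nonneg ((Q ^ n * (1 - Q)) * (1 - Q))"
      by (intro nonneg_mult pos Q1) (simp add: algebra_simps comm)
    then have "nonneg ((real n + 1) *\<^sub>R ((Q ^ n * (1 - Q)) * (1 - Q)))"
      by (intro nonneg_scaleR) auto
    from nonneg_add[OF Suc this] show ?case
      by (simp add: algebra_simps comm scaleR_2)
  qed simp
  have "nonneg (1 *\<^sub>R 1 - (real n + 1) *\<^sub>R (Q ^ n * (1 - Q)))"
    using nonneg_add[OF T[of n] nonneg_power[OF Q(1), of "Suc n"]] by simp
  then have "norm ((real n + 1) *\<^sub>R (Q ^ n * (1 - Q))) \<le> 1"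
    by (intro norm_le_of_nonneg_diff nonneg_scaleR pos) auto
  then have "(real n + 1) * norm (Q ^ n * (1 - Q)) \<le> 1" by simp
  then show ?thesis by (simp add: pos_le_divide_eq mult.commute)
qed

lemma geometric_sum_mult:
  fixes w :: "'a::ring_1"
  shows "(\<Sum>i<n. (1 - w) ^ i) * w = 1 - (1 - w) ^ n"
  by (induction n)
     (simp_all add: distrib_right power_Suc2 right_diff_distrib del: power_Suc)

text \<open>
An approximate unit made from \<open>w\<close>. By the geometric series the left-hand side is \<open>z - (1 - w)\<^sup>n z\<close>,
and \<open>\<parallel>(1 - w)\<^sup>n z\<parallel>\<^sup>2 = \<parallel>(1 - w)\<^sup>n w c (1 - w)\<^sup>n\<parallel>\<close> tends to \<open>0\<close> by
\<open>norm_power_mult_one_minus_le\<close>. It serves when \<open>w z\<close> is under control and \<open>z\<close> itself is not yet.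
\<close>

lemma tendsto_geometric_sum_mult:
  fixes w :: "'a::cstar_algebra_1"
  assumes w: "nonneg w" "norm w \<le> 1" and z: "adj z = z" "z * z = w * c"
  shows "(\<lambda>n. (\<Sum>i<n. (1 - w) ^ i) * (w * z)) \<longlonglongrightarrow> z"
proof -
  have Q: "nonneg (1 - w)" using w by (simp add: nonneg_one_minus nonneg_adj)
  have nQ: "norm (1 - w) \<le> 1" using nonneg_norm_diff_le[OF w] by simp
  have bd: "(norm ((1 - w) ^ n * z))\<^sup>2 \<le> norm c * (1 / (real n + 1))" for n
  proof -
    let ?q = "(1 - w) ^ n"
    have "(norm (?q * z))\<^sup>2 = norm ((?q * w) * c * ?q)"
      using cstar_identity'[of "?q * z"] Q z nonneg_adj[OF Q]
      by (metis adj_mult adj_power mult.assoc)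
    also have "\<dots> \<le> norm (?q * w) * norm c * norm ?q"
      by (intro order_trans[OF norm_mult_ineq] mult_right_mono norm_mult_ineq) simp
    also have "\<dots> \<le> (1 / (real n + 1)) * norm c * 1"
    proof (rule mult_mono)
      show "norm (?q * w) * norm c \<le> 1 / (real n + 1) * norm c"
        using norm_power_mult_one_minus_le[OF Q nQ, of n] by (intro mult_right_mono) simp_all
      show "norm ?q \<le> 1" by (rule order_trans[OF norm_power_ineq]) (simp add: nQ power_le_one)
    qed auto
    finally show ?thesis by (simp add: mult.commute)
  qed
  have "(\<lambda>n. norm c * (1 / (real n + 1))) \<longlonglongrightarrow> norm c * 0"
    by (intro tendsto_intros)
       (use LIMSEQ_inverse_real_of_nat in \<open>simp add: inverse_eq_divide add.commute\<close>)
  then have "(\<lambda>n. norm c * (1 / (real n + 1))) \<longlonglongrightarrow> 0" by simp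
  then have "(\<lambda>n. (norm ((1 - w) ^ n * z))\<^sup>2) \<longlonglongrightarrow> 0"
    by (rule Lim_null_comparison[OF always_eventually, rotated]) (use bd in simp)
  then have "(\<lambda>n. sqrt ((norm ((1 - w) ^ n * z))\<^sup>2)) \<longlonglongrightarrow> sqrt 0" by (rule tendsto_real_sqrt)
  then have "(\<lambda>n. (1 - w) ^ n * z) \<longlonglongrightarrow> 0" by (simp add: tendsto_norm_zero_iff)
  then have "(\<lambda>n. z - (1 - w) ^ n * z) \<longlonglongrightarrow> z - 0" by (intro tendsto_intros)
  moreover have "(\<Sum>i<n. (1 - w) ^ i) * (w * z) = z - (1 - w) ^ n * z" for n
    using geometric_sum_mult[of w n] by (simp add: mult.assoc[symmetric] left_diff_distrib)
  ultimately show ?thesis by simp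
qed

text \<open>
The root \<open>r\<close> is the limit of multiples of \<open>w r\<close>, and these lie in \<open>J\<close> because \<open>r\<close> multiplies \<open>J\<close>.
\<close>

lemma exists_nonneg_sqrt:
  fixes w :: "'a::cstar_algebra_1"
  assumes "nonneg w"
  shows "\<exists>r. nonneg r \<and> r * r = w \<and> (\<forall>c. c * w = w * c \<longrightarrow> c * r = r * c)
    \<and> (\<forall>J. closed_subalgebra J \<longrightarrow> w \<in> J \<longrightarrow> r \<in> J)"
proof -
  obtain r where r: "nonneg r" "r * r = w"
    and rc: "\<forall>c. c * w = w * c \<longrightarrow> c * r = r * c"
    and rJ: "\<forall>J. closed_subalgebra J \<longrightarrow> w \<in> J \<longrightarrow> r \<in> multipliers J"
    using exists_nonneg_sqrt_multiplier[OF assms] by blast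
  have rJ': "r \<in> J" if J: "closed_subalgebra J" "w \<in> J" for J
  proof (cases "w = 0")
    case True
    with r have "r = 0" using norm_selfadjoint_square[of r] by (simp add: nonneg_adj)
    with True J show ?thesis by simp
  next
    case False
    define C where "C = norm w"
    have C: "C > 0" using False by (simp add: C_def)
    define w' where "w' = (1 / C) *\<^sub>R w"
    have w': "nonneg w'" "norm w' \<le> 1"
      using C assms by (auto simp: w'_def C_def intro!: nonneg_scaleR)
    have lim: "(\<lambda>n. (\<Sum>i<n. (1 - w') ^ i) * (w' * r)) \<longlonglongrightarrow> r"
      by (rule tendsto_geometric_sum_mult[OF w', where c = "C *\<^sub>R 1"])
         (use r C in \<open>simp_all add: nonneg_adj w'_def\<close>)
    have mem: "(\<Sum>i<n. (1 - w') ^ i) * (w' * r) \<in> J" for n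
    proof -
      note M = closed_subalgebra_multipliers[OF J(1)]
      have sub: "subspace (multipliers J)" and subJ: "subspace J"
        using M J by (auto simp: closed_subalgebra_def)
      have "w' \<in> J" unfolding w'_def by (intro subspace_scale subJ J)
      then have "1 - w' \<in> multipliers J"
        using subset_multipliers[OF J(1)] by (intro subspace_diff sub one_in_multipliers) auto
      then have "(1 - w') ^ i \<in> multipliers J" for i
        using M by (induction i) (auto simp: one_in_multipliers closed_subalgebra_def)
      then have "(\<Sum>i<n. (1 - w') ^ i) \<in> multipliers J"
        by (intro subspace_sum sub) auto
      moreover have "w' * r \<in> J" using rJ J \<open>w' \<in> J\<close> by (auto simp: multipliers_def)
      ultimately show ?thesis by (auto simp: multipliers_def)
    qed
    have "closed J" using J(1) by (simp add: closed_subalgebra_def)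
    then show ?thesis using mem lim by (rule closed_sequentially)
  qed
  show ?thesis
    by (intro exI[of _ r] conjI allI impI) (fact r, fact r, simp add: rc, rule rJ')
qed

text \<open>
The parts are \<open>(\<bar>k\<bar> + k) / 2\<close> and \<open>(\<bar>k\<bar> - k) / 2\<close>, with \<open>r = \<bar>k\<bar>\<close> the root of \<open>k\<^sup>2\<close>. Their nonnegativity is the
point. For \<open>p = r + k\<close> one has \<open>p\<^sup>2 = 2 r p\<close>, so \<open>r p \<ge> 0\<close>, and \<open>p\<close> is a limit of products of \<open>r p\<close> with
commuting nonnegative elements.
\<close>

lemma positive_negative_parts:
  fixes k :: "'a::cstar_algebra_1"
  assumes k: "adj k = k"
  shows "\<exists>p m. nonneg p \<and> nonneg m \<and> k = p - m \<and> p * m = 0 \<and> m * p = 0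
    \<and> (\<forall>c. c * k = k * c \<longrightarrow> c * m = m * c)"
proof -
  obtain r where r: "nonneg r" "r * r = k * k" "\<forall>c. c * (k * k) = (k * k) * c \<longrightarrow> c * r = r * c"
    using exists_nonneg_sqrt[OF nonneg_square[OF k]] by blast
  have rc: "c * r = r * c" if "c * k = k * c" for c
    using that by (intro r(3)[rule_format]) (metis mult.assoc)
  have kr: "k * r = r * k" by (simp add: rc)
  have *: "nonneg (r + k)" if k: "adj k = k" and rk: "r * r = k * k" "k * r = r * k" for k
  proof -
    define p where "p = r + k"
    define C where "C = norm r + 1"
    have C: "C > 0" "norm r \<le> C" by (auto simp: C_def add_nonneg_pos)
    define w where "w = (1 / C) *\<^sub>R r"
    have w: "nonneg w" "norm w \<le> 1"
      using C r(1) by (auto simp: w_def intro!: nonneg_scaleR)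
    have p: "adj p = p" using r(1) k by (simp add: p_def adj_add nonneg_adj)
    have pp: "p * p = 2 *\<^sub>R (r * p)" using rk by (simp add: p_def algebra_simps scaleR_2)
    have wp: "w * p = (1 / (2 * C)) *\<^sub>R (p * p)" unfolding pp using C by (simp add: w_def)
    have pr: "p * r = r * p" using rk by (simp add: p_def algebra_simps)
    have "(\<lambda>n. (\<Sum>i<n. (1 - w) ^ i) * (w * p)) \<longlonglongrightarrow> p"
      by (rule tendsto_geometric_sum_mult[OF w p, where c = "(2 * C) *\<^sub>R p"])
         (use C in \<open>simp add: pp w_def\<close>)
    moreover have "nonneg ((\<Sum>i<n. (1 - w) ^ i) * (w * p))" for n
      unfolding sum_distrib_right
    proof (rule nonneg_sum, rule nonneg_mult, rule nonneg_power)
      show "nonneg (1 - w)" using w by (simp add: nonneg_one_minus nonneg_adj)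
      show "nonneg (w * p)" unfolding wp using C by (intro nonneg_scaleR nonneg_square p) auto
      have "(1 - w) * (w * p) = (w * p) * (1 - w)"
        using pr by (simp add: w_def algebra_simps)
      then show "(1 - w) ^ i * (w * p) = (w * p) * (1 - w) ^ i" for i
        by (induction i) (simp_all add: mult.assoc, metis mult.assoc)
    qed
    ultimately show ?thesis unfolding p_def[symmetric] by (rule nonneg_lim[rotated])
  qed
  show ?thesis
  proof (rule exI[of _ "(1/2) *\<^sub>R (r + k)"], rule exI[of _ "(1/2) *\<^sub>R (r + - k)"],
      intro conjI allI impI)
    show "nonneg ((1/2) *\<^sub>R (r + k))" by (intro nonneg_scaleR * k r kr) auto
    show "nonneg ((1/2) *\<^sub>R (r + - k))"
      using r(2) kr by (intro nonneg_scaleR *) (auto simp: adj_minus k)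
    show "k = (1/2) *\<^sub>R (r + k) - (1/2) *\<^sub>R (r + - k)"
      by (simp add: scaleR_right_diff_distrib[symmetric])
    show "(1/2) *\<^sub>R (r + k) * ((1/2) *\<^sub>R (r + - k)) = 0"
      "(1/2) *\<^sub>R (r + - k) * ((1/2) *\<^sub>R (r + k)) = 0"
      using kr r(2) by (simp_all add: algebra_simps)
    show "c * ((1/2) *\<^sub>R (r + - k)) = (1/2) *\<^sub>R (r + - k) * c" if "c * k = k * c" for c
      using rc[OF that] that by (simp add: algebra_simps)
  qed
qed

text \<open>
In terms of functions of \<open>v\<close>, \<open>G\<close> is \<open>\<lambda> \<mapsto> max (\<lambda> - \<alpha>) 0\<close> and \<open>1 - m / \<alpha>\<close> is \<open>\<lambda> \<mapsto> min \<lambda> \<alpha> / \<alpha>\<close>. The second acts as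
a unit on the first, since \<open>m G = 0\<close>, and its square is at most \<open>\<lambda> / \<alpha>\<close>.
\<close>

lemma exists_truncation:
  fixes v :: "'a::cstar_algebra_1"
  assumes v: "nonneg v" and \<alpha>: "0 < \<alpha>" "\<alpha> < norm v"
  obtains G m where "nonneg G" "nonneg m" "v - \<alpha> *\<^sub>R 1 = G - m" "G * m = 0" "m * G = 0" "G \<noteq> 0"
    "nonneg ((1 / \<alpha>) *\<^sub>R v - (1 - (1 / \<alpha>) *\<^sub>R m) * (1 - (1 / \<alpha>) *\<^sub>R m))"
proof -
  have sa: "adj (v - \<alpha> *\<^sub>R 1) = v - \<alpha> *\<^sub>R 1" using v by (simp add: adj_diff adj_scaleR nonneg_adj)
  obtain G m where G: "nonneg G" and m: "nonneg m" and k: "v - \<alpha> *\<^sub>R 1 = G - m"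
    and Gm: "G * m = 0" "m * G = 0"
    and comm: "\<forall>c. c * (v - \<alpha> *\<^sub>R 1) = (v - \<alpha> *\<^sub>R 1) * c \<longrightarrow> c * m = m * c"
    using positive_negative_parts[OF sa] by blast
  have vm: "v * m = m * v" by (intro comm[rule_format]) (simp add: algebra_simps)
  have veq: "v = \<alpha> *\<^sub>R 1 + G - m" using k by (simp add: algebra_simps)
  have "G \<noteq> 0"
  proof
    assume "G = 0"
    then have "nonneg (\<alpha> *\<^sub>R 1 - v)" using m veq by simp
    then show False using norm_le_of_nonneg_diff[OF v] \<alpha> by fastforce
  qed
  moreover have "(1 / \<alpha>) *\<^sub>R v - (1 - (1 / \<alpha>) *\<^sub>R m) * (1 - (1 / \<alpha>) *\<^sub>R m)
      = (1 / \<alpha>) *\<^sub>R G + (1 / \<alpha>\<^sup>2) *\<^sub>R (m * v)"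
    unfolding veq using \<alpha> Gm
    by (simp add: algebra_simps power2_eq_square)
  moreover have "nonneg \<dots>"
    using \<alpha> by (intro nonneg_add nonneg_scaleR nonneg_mult G m v) (auto simp: vm)
  ultimately show thesis using that[OF G m k Gm] by simp
qed

text \<open>
For powers of two this is the C*-identity; the other powers are squeezed between those.
\<close>

lemma norm_power_selfadjoint:
  fixes Q :: "'a::cstar_algebra_1"
  assumes Q: "adj Q = Q" "norm Q = 1"
  shows "norm (Q ^ n) = 1"
proof -
  have *: "norm (Q ^ (2 ^ j)) = 1" for j
  proof (induction j)
    case (Suc j)
    have "norm (Q ^ (2 ^ j) * Q ^ (2 ^ j)) = (norm (Q ^ (2 ^ j)))\<^sup>2"
      using Q by (intro norm_selfadjoint_square) (simp add: adj_power)
    with Suc show ?case by (simp add: power_add[symmetric] mult_2)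
  qed (simp add: Q)
  have le: "norm (Q ^ i) \<le> 1" for i using norm_power_ineq[of Q i] Q by simp
  have "n \<le> 2 ^ n" by simp
  then have "Q ^ (2 ^ n) = Q ^ n * Q ^ (2 ^ n - n)" by (simp add: power_add[symmetric])
  then have "1 \<le> norm (Q ^ n) * norm (Q ^ (2 ^ n - n))"
    using *[of n] norm_mult_ineq by metis
  also have "\<dots> \<le> norm (Q ^ n)" using le by (simp add: mult_left_le)
  finally show ?thesis using le[of n] by simp
qed

text \<open>
A Neumann series: with \<open>C = \<parallel>p\<parallel> + \<delta>\<close> the element \<open>1 - (p + \<delta>) / C\<close> has norm at most \<open>\<parallel>p\<parallel> / C < 1\<close>.
\<close>

lemma nonneg_add_pos_invertible:
  fixes p :: "'a::cstar_algebra_1"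
  assumes p: "nonneg p" and "0 < \<delta>"
  obtains q where "q * (p + \<delta> *\<^sub>R 1) = 1" "(p + \<delta> *\<^sub>R 1) * q = 1"
proof -
  define C where "C = norm p + \<delta>"
  have C: "C > 0" using assms by (simp add: C_def add_nonneg_pos)
  have norm_p: "norm p = C - \<delta>" by (simp add: C_def)
  define k where "k = 1 - (1 / C) *\<^sub>R (p + \<delta> *\<^sub>R 1)"
  have "k = (1 / C) *\<^sub>R (norm p *\<^sub>R 1 - p)"
    using C unfolding k_def
    by (simp add: scaleR_right_diff_distrib scaleR_right_distrib diff_divide_distrib
      scaleR_left_diff_distrib norm_p)
  then have "norm k \<le> (1 / C) * norm p"
    using nonneg_norm_diff_le[OF p order_refl] C by (simp add: divide_right_mono)
  also have "\<dots> < 1" using C \<open>0 < \<delta>\<close> by (simp add: C_def)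
  finally have "summable (\<lambda>n. k ^ n)" by (rule complete_algebra_summable_geometric)
  then have S: "(\<lambda>n. k ^ n) sums suminf (\<lambda>n. k ^ n)" by (rule summable_sums)
  define S' where "S' = suminf (\<lambda>n. k ^ n)"
  have "(\<lambda>n. k ^ Suc n) sums (S' - 1)"
    using sums_split_initial_segment[OF S, of 1] by (simp add: S'_def)
  moreover have "(\<lambda>n. k ^ Suc n) sums (k * S')" "(\<lambda>n. k ^ Suc n) sums (S' * k)"
    using sums_mult[OF S, of k] sums_mult2[OF S, of k] by (simp_all add: S'_def power_commutes)
  ultimately have "k * S' = S' - 1" "S' * k = S' - 1" using sums_unique2 by blast+
  then have inv: "(1 - k) * S' = 1" "S' * (1 - k) = 1" by (simp_all add: algebra_simps)
  have "p + \<delta> *\<^sub>R 1 = C *\<^sub>R (1 - k)" using C by (simp add: k_def)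
  with inv C show thesis by (intro that[of "(1 / C) *\<^sub>R S'"]) (simp_all)
qed

section \<open>The unitization\<close>

lemma scaleC_zero_left [simp]: "0 *\<^sub>C (x::'a::cstar_algebra) = 0"
  using scaleR_scaleC[of 0 x] by simp

lemma scaleC_one [simp]: "1 *\<^sub>C (x::'a::cstar_algebra) = x"
  using scaleR_scaleC[of 1 x] by simp

lemma scaleC_zero_right [simp]: "c *\<^sub>C (0::'a::cstar_algebra) = 0"
  using norm_scaleC[of c 0] by simp

text \<open>
The pair \<open>(x, c)\<close> stands for \<open>x + c 1\<close>. Its norm is the maximum of the norm of the operator of left
multiplication by it and of \<open>\<bar>c\<bar>\<close>. The operator norm alone is only a seminorm if the algebra already has
a unit. The second term is a C*-seminorm too, and the maximum of the two vanishes only at zero, so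
unital and nonunital algebras need no distinction.
\<close>

datatype 'a unitization = Unitization (elem: 'a) (scalar: complex)

lemma unitization_eqI: "elem u = elem v \<Longrightarrow> scalar u = scalar v \<Longrightarrow> u = v"
  by (rule unitization.expand) simp

instantiation unitization :: (cstar_algebra) real_algebra_1
begin

definition "0 = Unitization 0 0"
definition "1 = Unitization 0 1"
definition "u + v = Unitization (elem u + elem v) (scalar u + scalar v)"
definition "u - v = Unitization (elem u - elem v) (scalar u - scalar v)"
definition "- u = Unitization (- elem u) (- scalar u)"
definition "u * v = Unitization (elem u * elem v + scalar v *\<^sub>C elem u + scalar u *\<^sub>C elem v)
  (scalar u * scalar v)"
definition "r *\<^sub>R u = Unitization (r *\<^sub>R elem u) (complex_of_real r * scalar u)"

lemma elem_simps [simp]: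
  "elem 0 = 0" "elem 1 = 0" "elem (u + v) = elem u + elem v" "elem (u - v) = elem u - elem v"
  "elem (- u) = - elem u" "elem (r *\<^sub>R u) = r *\<^sub>R elem u"
  "elem (u * v) = elem u * elem v + scalar v *\<^sub>C elem u + scalar u *\<^sub>C elem v"
  by (simp_all add: zero_unitization_def one_unitization_def plus_unitization_def
    minus_unitization_def uminus_unitization_def times_unitization_def scaleR_unitization_def)

lemma scalar_simps [simp]:
  "scalar 0 = 0" "scalar 1 = 1" "scalar (u + v) = scalar u + scalar v"
  "scalar (u - v) = scalar u - scalar v"
  "scalar (- u) = - scalar u" "scalar (r *\<^sub>R u) = complex_of_real r * scalar u"
  "scalar (u * v) = scalar u * scalar v"
  by (simp_all add: zero_unitization_def one_unitization_def plus_unitization_def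
    minus_unitization_def uminus_unitization_def times_unitization_def scaleR_unitization_def)

instance
proof
  fix u v w :: "'a unitization" and r t :: real
  show "u * v * w = u * (v * w)"
    by (rule unitization_eqI)
       (simp_all add: algebra_simps mult_scaleC_left mult_scaleC_right scaleC_add_right
         scaleC_scaleC)
  show "(u + v) * w = u * w + v * w" "u * (v + w) = u * v + u * w"
    by (rule unitization_eqI; simp add: algebra_simps scaleC_add_right scaleC_add_left)+
  show "r *\<^sub>R u * v = r *\<^sub>R (u * v)" "u * r *\<^sub>R v = r *\<^sub>R (u * v)"
    by (rule unitization_eqI;
        simp add: algebra_simps scaleR_scaleC scaleC_scaleC scaleC_add_right
          mult_scaleC_left mult_scaleC_right)+
  show "(0::'a unitization) \<noteq> 1"
  proof
    assume "(0::'a unitization) = 1"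
    then have "scalar (0::'a unitization) = scalar (1::'a unitization)" by simp
    then show False by simp
  qed
qed (rule unitization_eqI; simp add: algebra_simps)+

end

definition left_action :: "'a::cstar_algebra unitization \<Rightarrow> 'a \<Rightarrow> 'a" where
  "left_action u a = elem u * a + scalar u *\<^sub>C a"

lemma bounded_linear_left_action: "bounded_linear (left_action u)"
proof (rule bounded_linear_intro)
  show "left_action u (x + y) = left_action u x + left_action u y" for x y
    by (simp add: left_action_def algebra_simps scaleC_add_right)
  show "left_action u (r *\<^sub>R x) = r *\<^sub>R left_action u x" for r x
    by (simp add: left_action_def scaleR_right_distrib)
       (simp add: scaleR_scaleC scaleC_scaleC mult.commute)
  show "norm (left_action u x) \<le> norm x * (norm (elem u) + cmod (scalar u))" for x
    unfolding left_action_def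
    by (rule norm_triangle_le)
       (use norm_mult_ineq[of "elem u" x] in \<open>simp add: norm_scaleC algebra_simps\<close>)
qed

lemma left_action_mult: "left_action (u * v) a = left_action u (left_action v a)"
  by (simp add: left_action_def algebra_simps mult_scaleC_left mult_scaleC_right
      scaleC_add_right scaleC_scaleC)

lemma norm_left_action_le: "norm (left_action u a) \<le> onorm (left_action u) * norm a"
  by (rule onorm[OF bounded_linear_left_action])

lemma onorm_left_action_le:
  "onorm (left_action u) \<le> norm (elem u) + cmod (scalar u)"
proof (rule onorm_bound)
  show "norm (left_action u x) \<le> (norm (elem u) + cmod (scalar u)) * norm x" for x
    unfolding left_action_def
    by (rule norm_triangle_le)
       (use norm_mult_ineq[of "elem u" x] in \<open>simp add: norm_scaleC algebra_simps\<close>)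
qed simp

text \<open>
Test the operator on \<open>x\<^sup>*\<close>, where \<open>x\<close> is the algebra component, and use \<open>\<parallel>x x\<^sup>*\<parallel> = \<parallel>x\<parallel>\<^sup>2\<close>. This compares the
norm of the unitization with the sum norm on pairs, hence gives definiteness and completeness.
\<close>

lemma norm_elem_le:
  "norm (elem u) \<le> onorm (left_action u) + cmod (scalar u)"
proof (cases "elem u = 0")
  case False
  let ?x = "elem u"
  have "norm ?x * norm ?x = norm (?x * adj ?x)" by (simp add: cstar_identity' power2_eq_square)
  also have "?x * adj ?x = left_action u (adj ?x) - scalar u *\<^sub>C adj ?x"
    by (simp add: left_action_def)
  also have "norm \<dots> \<le> onorm (left_action u) * norm ?x + cmod (scalar u) * norm ?x"
    using norm_left_action_le[of u "adj ?x"]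
    by (intro norm_triangle_le_diff) (simp add: norm_scaleC)
  also have "\<dots> = (onorm (left_action u) + cmod (scalar u)) * norm ?x"
    by (simp add: algebra_simps)
  finally show ?thesis using False by simp
qed (simp add: onorm_pos_le bounded_linear_left_action)

instantiation unitization :: (cstar_algebra) real_normed_algebra_1
begin

definition norm_unitization :: "'a unitization \<Rightarrow> real" where
  "norm u = max (onorm (left_action u)) (cmod (scalar u))"
definition dist_unitization :: "'a unitization \<Rightarrow> 'a unitization \<Rightarrow> real" where
  "dist_unitization u v = norm (u - v)"
definition sgn_unitization :: "'a unitization \<Rightarrow> 'a unitization" where
  "sgn_unitization u = u /\<^sub>R norm u"
definition uniformity_unitization :: "('a unitization \<times> 'a unitization) filter" where
  "uniformity_unitization = (INF e\<in>{0 <..}. principal {(u, v). dist u v < e})"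
definition open_unitization :: "'a unitization set \<Rightarrow> bool" where
  "open_unitization U \<longleftrightarrow> (\<forall>u\<in>U. \<forall>\<^sub>F (u', v) in uniformity. u' = u \<longrightarrow> v \<in> U)"

instance
proof
  fix u v :: "'a unitization" and r :: real and U :: "'a unitization set"
  show "dist u v = norm (u - v)" "sgn u = u /\<^sub>R norm u"
    "uniformity = (INF e\<in>{0 <..}. principal {(u, v). dist u (v::'a unitization) < e})"
    "open U \<longleftrightarrow> (\<forall>u\<in>U. \<forall>\<^sub>F (u', v) in uniformity. u' = u \<longrightarrow> v \<in> U)"
    by (simp_all only: dist_unitization_def sgn_unitization_def uniformity_unitization_def
      open_unitization_def)
  note bl = bounded_linear_left_action
  have o0: "0 \<le> onorm (left_action u)" for u :: "'a unitization" by (rule onorm_pos_le[OF bl])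
  show "norm u = 0 \<longleftrightarrow> u = 0"
  proof
    assume "norm u = 0"
    then have "onorm (left_action u) = 0" "scalar u = 0"
      using o0[of u] norm_ge_zero[of "scalar u"] unfolding norm_unitization_def
      by (smt (verit) norm_eq_zero)+
    with norm_elem_le[of u] show "u = 0" by (intro unitization_eqI) simp_all
  next
    assume "u = 0"
    then show "norm u = 0"
      using onorm_left_action_le[of u] o0[of u] by (simp add: norm_unitization_def)
  qed
  have "left_action (u + v) = (\<lambda>a. left_action u a + left_action v a)"
    by (auto simp: left_action_def algebra_simps scaleC_add_left)
  then have "onorm (left_action (u + v)) \<le> onorm (left_action u) + onorm (left_action v)"
    using onorm_triangle[OF bl bl] by simp
  moreover have "cmod (scalar (u + v)) \<le> cmod (scalar u) + cmod (scalar v)"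
    by (simp add: norm_triangle_ineq)
  ultimately show "norm (u + v) \<le> norm u + norm v"
    unfolding norm_unitization_def by linarith
  have "left_action (r *\<^sub>R u) = (\<lambda>a. r *\<^sub>R left_action u a)"
    by (rule ext)
       (simp add: left_action_def scaleR_scaleC scaleC_scaleC scaleC_add_right mult_scaleC_left)
  then have "onorm (left_action (r *\<^sub>R u)) = \<bar>r\<bar> * onorm (left_action u)"
    using onorm_scaleR[OF bl] by simp
  then show "norm (r *\<^sub>R u) = \<bar>r\<bar> * norm u"
    unfolding norm_unitization_def by (simp add: max_mult_distrib_left norm_mult)
  have "left_action (u * v) = left_action u \<circ> left_action v"
    by (auto simp: left_action_mult)
  then have "onorm (left_action (u * v)) \<le> onorm (left_action u) * onorm (left_action v)"
    using onorm_compose[OF bl bl] by simp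
  also have "\<dots> \<le> norm u * norm v"
    unfolding norm_unitization_def by (intro mult_mono) (auto simp: o0 le_max_iff_disj)
  finally have "onorm (left_action (u * v)) \<le> norm u * norm v" .
  moreover have "cmod (scalar (u * v)) \<le> norm u * norm v"
    unfolding norm_unitization_def by (auto simp: norm_mult le_max_iff_disj intro!: mult_mono)
  ultimately show "norm (u * v) \<le> norm u * norm v"
    by (simp add: norm_unitization_def[of "u * v"])
  show "norm (1::'a unitization) = 1"
    using onorm_left_action_le[of "1::'a unitization"] by (simp add: norm_unitization_def)
qed

end

lemma norm_elem_le_norm: "norm (elem u) \<le> 2 * norm (u::'a::cstar_algebra unitization)"
  using norm_elem_le[of u] unfolding norm_unitization_def by linarith

lemma norm_scalar_le_norm: "cmod (scalar u) \<le> norm (u::'a::cstar_algebra unitization)"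
  unfolding norm_unitization_def by simp

lemma norm_unitization_le:
  "norm u \<le> norm (elem u) + cmod (scalar (u::'a::cstar_algebra unitization))"
  using onorm_left_action_le[of u] unfolding norm_unitization_def by simp

instance unitization :: (cstar_algebra) banach
proof
  fix X :: "nat \<Rightarrow> 'a unitization"
  assume X: "Cauchy X"
  have "Cauchy (\<lambda>n. elem (X n))" unfolding Cauchy_iff
  proof (intro allI impI)
    fix e :: real assume "e > 0"
    then obtain M where M: "norm (X m - X n) < e / 2" if "m \<ge> M" "n \<ge> M" for m n
      using X unfolding Cauchy_iff by (meson half_gt_zero)
    show "\<exists>M. \<forall>m\<ge>M. \<forall>n\<ge>M. norm (elem (X m) - elem (X n)) < e"
    proof (intro exI[of _ M] allI impI)
      fix m n assume "m \<ge> M" "n \<ge> M"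
      with M[of m n] norm_elem_le_norm[of "X m - X n"]
      show "norm (elem (X m) - elem (X n)) < e" by simp
    qed
  qed
  then obtain x where x: "(\<lambda>n. elem (X n)) \<longlonglongrightarrow> x"
    using Cauchy_convergent convergent_def by blast
  have "Cauchy (\<lambda>n. scalar (X n))" unfolding Cauchy_iff
  proof (intro allI impI)
    fix e :: real assume "e > 0"
    then obtain M where M: "norm (X m - X n) < e" if "m \<ge> M" "n \<ge> M" for m n
      using X unfolding Cauchy_iff by meson
    show "\<exists>M. \<forall>m\<ge>M. \<forall>n\<ge>M. norm (scalar (X m) - scalar (X n)) < e"
    proof (intro exI[of _ M] allI impI)
      fix m n assume "m \<ge> M" "n \<ge> M"
      with M[of m n] norm_scalar_le_norm[of "X m - X n"]
      show "norm (scalar (X m) - scalar (X n)) < e" by simp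
    qed
  qed
  then obtain c where c: "(\<lambda>n. scalar (X n)) \<longlonglongrightarrow> c"
    using Cauchy_convergent convergent_def by blast
  let ?l = "Unitization x c"
  have "(\<lambda>n. norm (elem (X n) - x) + norm (scalar (X n) - c)) \<longlonglongrightarrow> norm (x - x) + norm (c - c)"
    by (intro tendsto_intros x c)
  then have lim: "(\<lambda>n. norm (elem (X n) - x) + norm (scalar (X n) - c)) \<longlonglongrightarrow> 0" by simp
  have "norm (X n - ?l) \<le> norm (elem (X n) - x) + norm (scalar (X n) - c)" for n
    using norm_unitization_le[of "X n - ?l"] by simp
  then have "(\<lambda>n. X n - ?l) \<longlonglongrightarrow> 0"
    by (intro Lim_null_comparison[OF always_eventually lim]) simp
  then have "X \<longlonglongrightarrow> ?l" by (simp add: LIM_zero_iff)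
  then show "convergent X" by (auto simp: convergent_def)
qed

instantiation unitization :: (cstar_algebra) cstar_algebra_1
begin

definition "c *\<^sub>C u = Unitization (c *\<^sub>C elem u) (c * scalar u)"
definition "adj u = Unitization (adj (elem u)) (cnj (scalar u))"

lemma unitization_star_simps [simp]:
  "elem (c *\<^sub>C u) = c *\<^sub>C elem u" "scalar (c *\<^sub>C u) = c * scalar u"
  "elem (adj u) = adj (elem u)" "scalar (adj u) = cnj (scalar u)"
  by (simp_all add: scaleC_unitization_def adj_unitization_def)

instance
proof
  fix u v :: "'a unitization" and c d :: complex and r :: real
  note bl = bounded_linear_left_action
  show "c *\<^sub>C (u + v) = c *\<^sub>C u + c *\<^sub>C v" "(c + d) *\<^sub>C u = c *\<^sub>C u + d *\<^sub>C u"
    "c *\<^sub>C (d *\<^sub>C u) = (c * d) *\<^sub>C u" "r *\<^sub>R u = complex_of_real r *\<^sub>C u"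
    "adj (adj u) = u" "adj (u + v) = adj u + adj v" "adj (c *\<^sub>C u) = cnj c *\<^sub>C adj u"
    by (rule unitization_eqI; simp add: algebra_simps scaleC_add_right scaleC_add_left
        scaleC_scaleC adj_adj adj_add adj_scaleC scaleR_scaleC)+
  show "(c *\<^sub>C u) * v = c *\<^sub>C (u * v)" "u * (c *\<^sub>C v) = c *\<^sub>C (u * v)"
    "adj (u * v) = adj v * adj u"
    by (rule unitization_eqI; simp add: algebra_simps scaleC_add_right scaleC_add_left
        mult_scaleC_left mult_scaleC_right scaleC_scaleC adj_add adj_scaleC adj_mult)+
  have *: "norm (c *\<^sub>C u) \<le> cmod c * norm u" for c and u :: "'a unitization"
  proof -
    have "left_action (c *\<^sub>C u) a = c *\<^sub>C left_action u a" for a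
      by (simp add: left_action_def scaleC_add_right mult_scaleC_left scaleC_scaleC)
    then have "norm (left_action (c *\<^sub>C u) a) \<le> (cmod c * onorm (left_action u)) * norm a" for a
      using norm_left_action_le[of u a] by (simp add: norm_scaleC mult_left_mono mult.assoc)
    then have "onorm (left_action (c *\<^sub>C u)) \<le> cmod c * onorm (left_action u)"
      by (intro onorm_bound) (simp_all add: onorm_pos_le bl)
    then show ?thesis
      unfolding norm_unitization_def by (auto simp: max_mult_distrib_left norm_mult)
  qed
  show "norm (c *\<^sub>C u) = cmod c * norm u"
  proof (cases "c = 0")
    case True
    then have "c *\<^sub>C u = 0" by (intro unitization_eqI) simp_all
    with True show ?thesis by simp
  next
    case False
    have "u = inverse c *\<^sub>C (c *\<^sub>C u)"
      using False by (intro unitization_eqI) (simp_all add: scaleC_scaleC)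
    then have "norm u \<le> cmod (inverse c) * norm (c *\<^sub>C u)" using * by metis
    then have "cmod c * norm u \<le> norm (c *\<^sub>C u)"
      using False by (simp add: norm_divide field_simps)
    with *[of c u] show ?thesis by simp
  qed
  have sq: "(norm u)\<^sup>2 \<le> norm (adj u * u)" for u :: "'a unitization"
  proof -
    have "norm (left_action u a) \<le> sqrt (onorm (left_action (adj u * u))) * norm a" for a
    proof -
      have "adj (left_action u a) * left_action u a = adj a * left_action (adj u * u) a"
        unfolding left_action_mult
        by (simp add: left_action_def adj_add adj_mult adj_scaleC algebra_simps
          mult_scaleC_left mult_scaleC_right scaleC_add_right scaleC_scaleC)
      then have "(norm (left_action u a))\<^sup>2 = norm (adj a * left_action (adj u * u) a)"
        by (simp add: cstar_identity[symmetric])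
      also have "\<dots> \<le> norm a * (onorm (left_action (adj u * u)) * norm a)"
        using norm_left_action_le[of "adj u * u" a]
        by (intro order_trans[OF norm_mult_ineq]) (simp add: mult_left_mono)
      also have "\<dots> = (sqrt (onorm (left_action (adj u * u))) * norm a)\<^sup>2"
        by (simp add: power_mult_distrib onorm_pos_le bl power2_eq_square)
      finally show ?thesis by (rule power2_le_imp_le) (simp add: onorm_pos_le bl)
    qed
    then have "onorm (left_action u) \<le> sqrt (onorm (left_action (adj u * u)))"
      by (intro onorm_bound) (simp_all add: onorm_pos_le bl)
    then have "(onorm (left_action u))\<^sup>2 \<le> onorm (left_action (adj u * u))"
      using power_mono[of "onorm (left_action u)" _ 2] by (force simp: onorm_pos_le bl)
    moreover have "(cmod (scalar u))\<^sup>2 = cmod (scalar (adj u * u))"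
      by (simp add: norm_mult power2_eq_square)
    ultimately show ?thesis unfolding norm_unitization_def by (auto simp: max_def)
  qed
  have le: "norm u \<le> norm (adj u)" for u :: "'a unitization"
  proof (cases "norm u = 0")
    case False
    have "norm u * norm u \<le> norm (adj u) * norm u"
      using sq[of u] norm_mult_ineq[of "adj u" u] by (simp add: power2_eq_square)
    with False show ?thesis by (simp add: mult_le_cancel_right)
  qed simp
  have "adj (adj u) = u" by (rule unitization_eqI) (simp_all add: adj_adj)
  then have "norm (adj u) \<le> norm u" using le[of "adj u"] by simp
  then have "norm (adj u * u) \<le> (norm u)\<^sup>2"
    unfolding power2_eq_square by (intro order_trans[OF norm_mult_ineq] mult_right_mono) simp_all
  with sq[of u] show "norm (adj u * u) = (norm u)\<^sup>2" by simp
qed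

end

definition unitize :: "'a::cstar_algebra \<Rightarrow> 'a unitization" where
  "unitize x = Unitization x 0"

lemma unitize_simps [simp]: "elem (unitize x) = x" "scalar (unitize x) = 0"
  by (simp_all add: unitize_def)

lemma unitize_elem: "scalar u = 0 \<Longrightarrow> unitize (elem u) = u"
  by (rule unitization_eqI) simp_all

lemma unitize_eq_iff [simp]: "unitize x = unitize y \<longleftrightarrow> x = y"
  by (simp add: unitize_def)

lemma
  shows unitize_zero: "unitize 0 = 0"
    and unitize_add: "unitize (x + y) = unitize x + unitize y"
    and unitize_mult: "unitize (x * y) = unitize x * unitize y"
    and unitize_adj: "unitize (adj x) = adj (unitize x)"
    and unitize_scaleR: "unitize (r *\<^sub>R x) = r *\<^sub>R unitize x"
  by (rule unitization_eqI; simp)+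

lemmas unitize_arith = unitize_zero unitize_add unitize_mult unitize_adj unitize_scaleR

lemma norm_unitize [simp]: "norm (unitize x) = norm x"
proof (rule antisym)
  show "norm (unitize x) \<le> norm x" using norm_unitization_le[of "unitize x"] by simp
  show "norm x \<le> norm (unitize x)"
    using norm_elem_le[of "unitize x"] unfolding norm_unitization_def by simp
qed

lemma bounded_linear_unitize: "bounded_linear (unitize :: 'a::cstar_algebra \<Rightarrow> _)"
  by (rule bounded_linear_intro[where K = 1]) (simp_all add: unitize_arith)

lemma closed_subalgebra_unitize:
  assumes "closed_subalgebra (J :: 'a::cstar_algebra set)"
  shows "closed_subalgebra (unitize ` J)"
proof -
  have J: "subspace J" "\<And>x y. x \<in> J \<Longrightarrow> y \<in> J \<Longrightarrow> x * y \<in> J" "closed J"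
    using assms by (auto simp: closed_subalgebra_def)
  have "complete (unitize ` J)"
    using J(1,3) complete_isometric_image[of 1 J unitize] bounded_linear_unitize complete_eq_closed
    by auto
  then have "closed (unitize ` J)" by (rule complete_imp_closed)
  moreover have "subspace (unitize ` J)"
    by (rule linear_subspace_image[OF bounded_linear.linear[OF bounded_linear_unitize] J(1)])
  moreover have "x * y \<in> unitize ` J" if "x \<in> unitize ` J" "y \<in> unitize ` J" for x y
    using that J(2) by (auto simp: unitize_mult[symmetric])
  ultimately show ?thesis by (simp add: closed_subalgebra_def)
qed

section \<open>Spectral positivity\<close>

text \<open>
A negative real \<open>z\<close> is covered by \<open>nonneg_add_pos_invertible\<close>. For nonreal \<open>z\<close> the same lemma inverts
\<open>(e - z) (e - cnj z) = (e - Re z)\<^sup>2 + (Im z)\<^sup>2\<close>, and both factors commute with that product.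
\<close>

lemma nonneg_minus_invertible:
  fixes e :: "'a::cstar_algebra_1"
  assumes e: "nonneg e" and z: "z \<notin> complex_of_real ` {0..}"
  shows "\<exists>v. v * (e - z *\<^sub>C 1) = 1 \<and> (e - z *\<^sub>C 1) * v = 1"
proof (cases "Im z = 0")
  case True
  then have zr: "z = complex_of_real (Re z)" by (simp add: complex_eq_iff)
  then have "Re z < 0" using z by (metis atLeast_iff imageI not_le)
  moreover have "e - z *\<^sub>C 1 = e + (- Re z) *\<^sub>R 1"
    by (subst zr) (simp add: scaleR_scaleC[symmetric])
  ultimately show ?thesis using nonneg_add_pos_invertible[OF e, of "- Re z"] by auto
next
  case False
  define A where "A = e - Re z *\<^sub>R 1"
  define I where "I = (\<i> *\<^sub>C 1 :: 'a)"
  have Ic: "I * y = y * I" for y by (simp add: I_def mult_scaleC_left mult_scaleC_right)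
  have II: "I * I = - 1"
    using scaleR_scaleC[of "-1" "1::'a"]
    by (simp add: I_def mult_scaleC_left mult_scaleC_right scaleC_scaleC)
  define N where "N = A + Im z *\<^sub>R I"
  have "z *\<^sub>C (1::'a) = Re z *\<^sub>R 1 + Im z *\<^sub>R I"
    unfolding I_def scaleR_scaleC scaleC_scaleC scaleC_add_left[symmetric]
    by (simp add: complex_eq[symmetric] mult.commute)
  then have M: "e - z *\<^sub>C 1 = A - Im z *\<^sub>R I" by (simp add: A_def)
  have "adj A = A" using e by (simp add: A_def adj_diff adj_scaleR nonneg_adj)
  then have "nonneg (A * A)" by (rule nonneg_square)
  then obtain q where q: "q * (A * A + (Im z)\<^sup>2 *\<^sub>R 1) = 1" "(A * A + (Im z)\<^sup>2 *\<^sub>R 1) * q = 1"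
    using False nonneg_add_pos_invertible[of "A * A" "(Im z)\<^sup>2"] by auto
  have "(A - Im z *\<^sub>R I) * N = A * A + (Im z)\<^sup>2 *\<^sub>R 1" "N * (A - Im z *\<^sub>R I) = A * A + (Im z)\<^sup>2 *\<^sub>R 1"
    using II Ic[of A] by (simp_all add: N_def algebra_simps power2_eq_square)
  then have l: "(q * N) * (A - Im z *\<^sub>R I) = 1" and r: "(A - Im z *\<^sub>R I) * (N * q) = 1"
    using q by (simp_all add: mult.assoc) (simp add: mult.assoc[symmetric])
  have "q * N = (q * N) * ((A - Im z *\<^sub>R I) * (N * q))" using r by simp
  also have "\<dots> = N * q" using l by (simp add: mult.assoc[symmetric])
  finally show ?thesis using l r unfolding M by auto
qed

lemma cstar_positive_of_nonneg:
  assumes "nonneg (unitize x)"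
  shows "cstar_positive x"
proof -
  have "unitize (adj x) = unitize x" using nonneg_adj[OF assms] by (simp add: unitize_arith)
  moreover have "z \<in> complex_of_real ` {0..}" if "z \<in> cstar_spectrum x" for z
  proof (rule ccontr)
    assume "z \<notin> complex_of_real ` {0..}"
    then obtain v where "v * (unitize x - z *\<^sub>C 1) = 1" "(unitize x - z *\<^sub>C 1) * v = 1"
      using nonneg_minus_invertible[OF assms] by blast
    moreover have "unitize x - z *\<^sub>C 1 = Unitization x (- z)"
      by (rule unitization_eqI) simp_all
    ultimately have v: "v * Unitization x (- z) = 1" "Unitization x (- z) * v = 1" by simp_all
    have "unitization_mult (x, - z) (elem v, scalar v) = (0, 1)"
      "unitization_mult (elem v, scalar v) (x, - z) = (0, 1)"
      using arg_cong[OF v(1), of elem] arg_cong[OF v(1), of scalar]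
        arg_cong[OF v(2), of elem] arg_cong[OF v(2), of scalar]
      by (simp_all add: unitization_mult_def)
    with that show False unfolding cstar_spectrum_def by blast
  qed
  ultimately show ?thesis by (auto simp: cstar_positive_def)
qed

section \<open>Annihilators\<close>

lemma continuous_on_adj: "continuous_on S (adj :: 'a::cstar_algebra \<Rightarrow> 'a)"
  by (rule bounded_linear.continuous_on[OF bounded_linear_adj continuous_on_id])

lemma perp_hereditary:
  assumes "d \<in> perp S" "d' \<in> perp S"
  shows "d * x * d' \<in> perp S" "d * d' \<in> perp S"
  using assms by (simp_all add: perp_def cstar_orthogonal_def adj_mult mult.assoc[symmetric])

lemma adj_in_perp: "d \<in> perp S \<Longrightarrow> adj d \<in> perp S"
  by (simp add: perp_def cstar_orthogonal_def adj_adj)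

lemma closed_subalgebra_perp: "closed_subalgebra (perp S)"
proof -
  have "subspace (perp S)"
    by (auto simp: subspace_def perp_def cstar_orthogonal_def algebra_simps adj_add adj_scaleR)
  moreover have "perp S = (\<Inter>s\<in>S. {b. s * b = 0} \<inter> {b. s * adj b = 0})"
    by (auto simp: perp_def cstar_orthogonal_def)
  moreover have "closed {b. s * b = 0}" "closed {b. s * adj b = 0}" for s :: 'a
    by (intro closed_Collect_eq continuous_intros continuous_on_adj)+
  ultimately show ?thesis
    unfolding closed_subalgebra_def
    by (metis (no_types, lifting) closed_INT closed_Int perp_hereditary(2))
qed

lemma in_perp_perp: "adj G = G \<Longrightarrow> G \<in> perp (perp {G})"
  by (auto simp: perp_def cstar_orthogonal_def) (metis adj_adj adj_mult adj_zero)+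

lemma closed_subalgebra_cstar_subalgebra:
  assumes "cstar_subalgebra B"
  shows "closed_subalgebra B"
  using assms by (auto simp: cstar_subalgebra_def closed_subalgebra_def subspace_def scaleR_scaleC)

section \<open>Norms of products of unit balls\<close>

lemma nonneg_unitize_zero: "nonneg (unitize 0)" by (simp add: unitize_arith)

lemma zero_in_pos_unit_ball: "0 \<in> B \<Longrightarrow> 0 \<in> pos_unit_ball B"
  by (simp add: pos_unit_ball_def cstar_positive_of_nonneg nonneg_unitize_zero)

lemma norm_pos_unit_ball: "b \<in> pos_unit_ball B \<Longrightarrow> norm b \<le> 1"
  by (simp add: pos_unit_ball_def)

lemma adj_pos_unit_ball: "b \<in> pos_unit_ball B \<Longrightarrow> adj b = b"
  by (simp add: pos_unit_ball_def cstar_positive_def)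

lemma bdd_above_prod_norm:
  "bdd_above ((\<lambda>(b, c). norm (b * c)) ` (pos_unit_ball B \<times> pos_unit_ball C))"
proof (rule bdd_aboveI2)
  fix p assume "p \<in> pos_unit_ball B \<times> pos_unit_ball C"
  then show "(case p of (b, c) \<Rightarrow> norm (b * c)) \<le> 1"
    by (auto dest!: norm_pos_unit_ball intro!: order_trans[OF norm_mult_ineq] mult_le_one)
qed

lemma le_prod_norm:
  "b \<in> pos_unit_ball B \<Longrightarrow> c \<in> pos_unit_ball C \<Longrightarrow> norm (b * c) \<le> prod_norm B C"
  unfolding prod_norm_def
  using cSUP_upper[OF _ bdd_above_prod_norm, of "(b, c)"] by auto

lemma prod_norm_nonneg:
  assumes "0 \<in> B" "0 \<in> C"
  shows "0 \<le> prod_norm B C"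
  using le_prod_norm[OF zero_in_pos_unit_ball zero_in_pos_unit_ball, OF assms] by simp

lemma prod_norm_le:
  assumes "0 \<in> B" "0 \<in> C"
    and "\<And>b c. b \<in> pos_unit_ball B \<Longrightarrow> c \<in> pos_unit_ball C \<Longrightarrow> norm (b * c) \<le> K"
  shows "prod_norm B C \<le> K"
  unfolding prod_norm_def
  by (rule cSUP_least) (use assms zero_in_pos_unit_ball in auto)

lemma less_prod_norm:
  assumes "0 \<in> B" "0 \<in> C" "K < prod_norm B C"
  shows "\<exists>b\<in>pos_unit_ball B. \<exists>c\<in>pos_unit_ball C. K < norm (b * c)"
proof (rule ccontr)
  assume "\<not> ?thesis"
  then have "prod_norm B C \<le> K" using assms by (intro prod_norm_le) (auto simp: not_less)
  with assms(3) show False by simp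
qed

text \<open>
The supremum over the positive unit ball controls every element of the annihilator: \<open>\<parallel>b y\<parallel>\<close> depends on
\<open>y\<close> only through \<open>y y\<^sup>*\<close>, so \<open>y\<close> may be replaced by the positive root of \<open>y y\<^sup>*\<close>.
\<close>

lemma norm_mult_le_prod_norm:
  assumes b: "b \<in> pos_unit_ball B" and y: "y \<in> perp S"
  shows "norm (b * y) \<le> prod_norm B (perp S) * norm y"
proof (cases "y = 0")
  case False
  then have ny: "norm y > 0" by simp
  let ?J = "unitize ` perp S"
  have "nonneg (unitize (y * adj y))" using nonneg_self_mult_adj by (simp add: unitize_arith)
  then obtain r where r: "nonneg r" "r * r = unitize (y * adj y)"
    and rJ: "\<forall>J. closed_subalgebra J \<longrightarrow> unitize (y * adj y) \<in> J \<longrightarrow> r \<in> J"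
    using exists_nonneg_sqrt by blast
  have "unitize (y * adj y) \<in> ?J" using perp_hereditary(2)[OF y adj_in_perp[OF y]] by blast
  then have "r \<in> ?J" using rJ closed_subalgebra_unitize[OF closed_subalgebra_perp] by blast
  then obtain c where c: "r = unitize c" "c \<in> perp S" by blast
  have cc: "c * c = y * adj y" using r(2) by (simp add: c unitize_mult[symmetric])
  have sac: "adj c = c" using nonneg_adj[OF r(1)] by (simp add: c unitize_adj[symmetric])
  have "(norm c)\<^sup>2 = (norm y)\<^sup>2"
    using norm_selfadjoint_square[OF sac] by (simp add: cc cstar_identity')
  then have nc: "norm c = norm y" by simp
  let ?c = "(1 / norm y) *\<^sub>R c"
  have "nonneg (unitize ?c)" using r(1) by (simp add: c unitize_arith nonneg_scaleR)
  moreover have "?c \<in> perp S"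
    using c(2) closed_subalgebra_perp[of S] subspace_scale unfolding closed_subalgebra_def by blast
  ultimately have "?c \<in> pos_unit_ball (perp S)"
    using nc ny by (simp add: pos_unit_ball_def cstar_positive_of_nonneg)
  from le_prod_norm[OF b this] have bc: "norm (b * c) \<le> prod_norm B (perp S) * norm y"
    using ny by (simp add: pos_divide_le_eq)
  have "(b * y) * adj (b * y) = (b * c) * adj (b * c)"
    using cc by (simp add: adj_mult sac) (metis mult.assoc)
  then have "(norm (b * y))\<^sup>2 = (norm (b * c))\<^sup>2" by (metis cstar_identity')
  then show ?thesis using bc by simp
qed simp

section \<open>Elements almost orthogonal to a subalgebra\<close>

text \<open>
Put \<open>a = d b\<^sup>2 d\<close>, of norm \<open>T\<close>, let \<open>g = (a / T)\<^sup>n\<close> and \<open>s = sqrt (1 - b\<^sup>2)\<close>, and consider \<open>x = s d g\<close>. For large \<open>n\<close>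
multiplication by \<open>g\<close> localises to where \<open>a\<close> is close to its norm.

For a self-adjoint contraction \<open>u\<close> in \<open>B\<close> the element \<open>w = b\<^sup>2 + s u\<^sup>2 s\<close> is again a nonnegative contraction
in \<open>B\<close>, so \<open>d w d \<le> \<tau>\<^sup>2\<close> by the hypothesis on \<open>\<tau>\<close>, applied to the root of \<open>w\<close>. Therefore
\<open>(u x)\<^sup>* (u x) = g (d w d - a) g \<le> g (\<tau>\<^sup>2 - a) g\<close>, and the last element is small if \<open>T\<close> is close to \<open>\<tau>\<^sup>2\<close> and \<open>n\<close>
is large: \<open>b\<close> already takes almost all that \<open>B\<close> is allowed to take there, so nothing is left for \<open>s u\<^sup>2 s\<close>.

On the other hand \<open>x\<close> is not small. From \<open>T = \<parallel>g a g\<parallel> = \<parallel>b d g\<parallel>\<^sup>2 \<le> \<tau>\<^sup>2 \<parallel>d g\<parallel>\<^sup>2\<close> and \<open>x\<^sup>* x = g d\<^sup>2 g - g a g\<close> follows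
\<open>\<parallel>x\<parallel>\<^sup>2 \<ge> T / \<tau>\<^sup>2 - T\<close>.
\<close>

lemma exists_almost_orthogonal:
  fixes B D :: "'a::cstar_algebra_1 set"
  assumes B: "closed_subalgebra B" and D: "closed_subalgebra D"
    and her: "\<And>x y z. x \<in> D \<Longrightarrow> y \<in> D \<Longrightarrow> x * z * y \<in> D"
    and \<tau>: "0 < \<tau>" "\<tau> < 1"
    and H: "\<And>r y. r \<in> B \<Longrightarrow> nonneg r \<Longrightarrow> norm r \<le> 1 \<Longrightarrow> y \<in> D \<Longrightarrow> norm (r * y) \<le> \<tau> * norm y"
    and b: "b \<in> B" "adj b = b" "norm b \<le> 1"
    and d: "d \<in> D" "adj d = d" "norm d \<le> 1"
    and T: "T = (norm (b * d))\<^sup>2" "0 < T"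
  shows "\<exists>s g. T * (1 - \<tau>\<^sup>2) / \<tau>\<^sup>2 \<le> (norm (s * d * g))\<^sup>2
    \<and> (\<forall>u\<in>B. adj u = u \<longrightarrow> norm u \<le> 1 \<longrightarrow>
        (norm (u * (s * d * g)))\<^sup>2 \<le> (\<tau>\<^sup>2 - T) + 1 / (real (2 * n) + 1))"
proof -
  have Bm: "x * y \<in> B" "x + y \<in> B" if "x \<in> B" "y \<in> B" for x y
    using B that by (auto simp: closed_subalgebra_def subspace_add)
  have cut: "norm (adj y * w * y) \<le> \<tau>\<^sup>2 * (norm y)\<^sup>2"
    if w: "w \<in> B" "nonneg w" "norm w \<le> 1" and y: "y \<in> D" for w y
  proof -
    obtain r where r: "nonneg r" "r * r = w"
      and rJ: "\<forall>J. closed_subalgebra J \<longrightarrow> w \<in> J \<longrightarrow> r \<in> J"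
      using exists_nonneg_sqrt[OF w(2)] by blast
    have "(norm r)\<^sup>2 \<le> 1"
      using norm_selfadjoint_square[of r] r w by (simp add: nonneg_adj)
    then have "norm r \<le> 1" by (simp add: abs_square_le_1)
    then have "norm (r * y) \<le> \<tau> * norm y" using H rJ B w(1) r(1) y by blast
    then have "(norm (r * y))\<^sup>2 \<le> (\<tau> * norm y)\<^sup>2" by (simp add: power_mono)
    moreover have "adj (r * y) * (r * y) = adj y * w * y"
      using r(1) unfolding r(2)[symmetric] by (simp add: adj_mult nonneg_adj mult.assoc)
    ultimately show ?thesis by (metis cstar_identity power_mult_distrib)
  qed
  have bb: "nonneg (b * b)" "norm (b * b) \<le> 1" "b * b \<in> B"
    using b Bm by (auto simp: nonneg_square norm_selfadjoint_square power_le_one)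
  have "closed_subalgebra (multipliers B)" "b * b \<in> multipliers B"
    using closed_subalgebra_multipliers[OF B] subset_multipliers[OF B] bb by auto
  moreover obtain s where s: "adj s = s" "s * s = 1 - b * b"
    and sJ: "\<forall>J. closed_subalgebra J \<longrightarrow> 1 \<in> J \<longrightarrow> b * b \<in> J \<longrightarrow> s \<in> J"
    using sqrt_one_minus[OF nonneg_adj[OF bb(1)] bb(2)] by blast
  ultimately have sM: "s \<in> multipliers B" using one_in_multipliers by blast
  define a where "a = d * (b * b) * d"
  have a: "a = adj (b * d) * (b * d)" by (simp add: a_def adj_mult b d mult.assoc)
  have na: "norm a = T" unfolding a T by (rule cstar_identity)
  have pa: "nonneg a" unfolding a by (rule nonneg_adj_mult_self)
  have "norm a \<le> \<tau>\<^sup>2 * (norm d)\<^sup>2" using cut[OF bb(3,1,2) d(1)] by (simp add: a_def d)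
  also have "\<dots> \<le> \<tau>\<^sup>2 * 1" using d(3) by (intro mult_left_mono) (auto simp: power_le_one)
  finally have T\<tau>: "T \<le> \<tau>\<^sup>2" by (simp add: na)
  have \<tau>1: "\<tau>\<^sup>2 \<le> 1" using \<tau> by (simp add: power_le_one)
  define Q where "Q = (1 / T) *\<^sub>R a"
  have Q: "nonneg Q" "norm Q = 1" and aQ: "a = T *\<^sub>R Q"
    using pa na T(2) by (auto simp: Q_def intro!: nonneg_scaleR)
  define g where "g = Q ^ n"
  have pg: "nonneg g" unfolding g_def by (intro nonneg_power Q)
  note ag = nonneg_adj[OF pg]
  have ng: "norm (Q ^ i) = 1" for i using norm_power_selfadjoint Q nonneg_adj by blast
  have "a \<in> D" unfolding a_def by (intro her d)
  then have "Q \<in> D"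
    using D unfolding Q_def closed_subalgebra_def by (simp add: subspace_scale)
  then have "Q \<in> multipliers D" using subset_multipliers[OF D] by blast
  then have "g \<in> multipliers D"
    using closed_subalgebra_multipliers[OF D] unfolding g_def
    by (induction n) (auto simp: one_in_multipliers closed_subalgebra_def)
  then have y: "d * g \<in> D" using d(1) by (auto simp: multipliers_def)
  define x where "x = s * d * g"
  have gg: "Q ^ (2 * n) = g * g" by (simp add: g_def power_add mult_2)
  have gQ: "Q * g = g * Q" by (simp add: g_def power_commutes)
  have gag: "g * a * g = T *\<^sub>R Q ^ (2 * n + 1)"
    by (simp add: aQ g_def power_add mult_2 power_commutes mult.assoc)
  have "T = norm (g * a * g)" using T(2) by (simp add: gag ng del: power_Suc)
  also have "g * a * g = adj (d * g) * (b * b) * (d * g)"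
    by (simp add: a_def adj_mult ag d mult.assoc)
  also have "norm \<dots> \<le> \<tau>\<^sup>2 * (norm (d * g))\<^sup>2" by (rule cut[OF bb(3,1,2) y])
  finally have low: "T / \<tau>\<^sup>2 \<le> (norm (d * g))\<^sup>2" using \<tau> by (simp add: field_simps)
  have "adj x * x = g * d * (s * s) * d * g" by (simp add: x_def adj_mult ag d s(1) mult.assoc)
  also have "\<dots> = adj (d * g) * (d * g) - g * a * g"
    unfolding s(2) by (simp add: a_def adj_mult ag d algebra_simps)
  finally have "adj (d * g) * (d * g) = adj x * x + g * a * g" by (simp add: algebra_simps)
  then have "norm (adj (d * g) * (d * g)) \<le> norm (adj x * x) + norm (g * a * g)"
    by (simp only: norm_triangle_ineq)
  then have "(norm (d * g))\<^sup>2 \<le> (norm x)\<^sup>2 + T"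
    unfolding cstar_identity using T(2) by (simp add: gag ng del: power_Suc)
  with low have "T / \<tau>\<^sup>2 - T \<le> (norm x)\<^sup>2" by simp
  moreover have "T / \<tau>\<^sup>2 - T = T * (1 - \<tau>\<^sup>2) / \<tau>\<^sup>2" using \<tau> by (simp add: field_simps)
  ultimately have part1: "T * (1 - \<tau>\<^sup>2) / \<tau>\<^sup>2 \<le> (norm x)\<^sup>2" by simp
  have part2: "(norm (u * x))\<^sup>2 \<le> (\<tau>\<^sup>2 - T) + 1 / (real (2 * n) + 1)"
    if u: "u \<in> B" "adj u = u" "norm u \<le> 1" for u
  proof -
    define w where "w = b * b + s * (u * u) * s"
    have uu: "nonneg (u * u)" "norm (u * u) \<le> 1"
      using u by (auto simp: nonneg_square norm_selfadjoint_square power_le_one)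
    have wB: "w \<in> B" unfolding w_def
      using sM Bm u(1) bb(3) by (simp add: multipliers_def)
    have pw: "nonneg w" unfolding w_def
      using nonneg_conj[OF uu(1), of s] bb(1) s(1) by (simp add: nonneg_add)
    have "1 *\<^sub>R 1 - w = adj s * (1 - u * u) * s"
      using s by (simp add: w_def algebra_simps)
    moreover have "nonneg (1 - u * u)" using uu by (intro nonneg_one_minus nonneg_adj)
    ultimately have "nonneg (1 *\<^sub>R 1 - w)" using nonneg_conj by simp
    then have "norm w \<le> 1" by (intro norm_le_of_nonneg_diff pw) auto
    define K where "K = d * w * d"
    have "norm K \<le> \<tau>\<^sup>2 * (norm d)\<^sup>2"
      using cut[OF wB pw \<open>norm w \<le> 1\<close> d(1)] by (simp add: K_def d)
    also have "\<dots> \<le> \<tau>\<^sup>2 * 1" using d(3) by (intro mult_left_mono) (auto simp: power_le_one)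
    finally have nK: "norm K \<le> \<tau>\<^sup>2" by simp
    have "nonneg K" unfolding K_def using nonneg_conj[OF pw, of d] by (simp add: d)
    then have "nonneg (\<tau>\<^sup>2 *\<^sub>R 1 - K)" by (intro nonneg_diff_of_norm_le nonneg_adj nK)
    then have "nonneg (adj g * (\<tau>\<^sup>2 *\<^sub>R 1 - K) * g)" by (rule nonneg_conj)
    moreover have ux: "adj (u * x) * (u * x) = g * (K - a) * g"
      by (simp add: x_def K_def a_def w_def adj_mult ag d s(1) u(2) algebra_simps)
    then have "g * (\<tau>\<^sup>2 *\<^sub>R 1 - a) * g - adj (u * x) * (u * x) = adj g * (\<tau>\<^sup>2 *\<^sub>R 1 - K) * g"
      by (simp add: ag algebra_simps)
    ultimately have "norm (adj (u * x) * (u * x)) \<le> norm (g * (\<tau>\<^sup>2 *\<^sub>R 1 - a) * g)"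
      by (intro norm_mono nonneg_adj_mult_self) simp
    also have "g * (\<tau>\<^sup>2 *\<^sub>R 1 - a) * g = (\<tau>\<^sup>2 - T) *\<^sub>R Q ^ (2 * n) + T *\<^sub>R (Q ^ (2 * n) * (1 - Q))"
      unfolding gg aQ using gQ by (simp add: algebra_simps)
    also have "norm \<dots> \<le> (\<tau>\<^sup>2 - T) + T * (1 / (real (2 * n) + 1))"
    proof (rule norm_triangle_mono)
      show "norm ((\<tau>\<^sup>2 - T) *\<^sub>R Q ^ (2 * n)) \<le> \<tau>\<^sup>2 - T" using T\<tau> by (simp add: ng)
      show "norm (T *\<^sub>R (Q ^ (2 * n) * (1 - Q))) \<le> T * (1 / (real (2 * n) + 1))"
        using norm_power_mult_one_minus_le[OF Q(1), of "2 * n"] Q(2) T(2)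
        unfolding norm_scaleR by (intro mult_mono) auto
    qed
    also have "\<dots> \<le> (\<tau>\<^sup>2 - T) + 1 * (1 / (real (2 * n) + 1))"
      using T\<tau> \<tau>1 by (intro add_left_mono mult_right_mono) auto
    finally show ?thesis by (simp add: cstar_identity)
  qed
  show ?thesis
    by (rule exI[of _ s], rule exI[of _ g]) (use part1 part2 in \<open>simp add: x_def\<close>)
qed

section \<open>Annihilators almost orthogonal to a subalgebra\<close>

lemma scalar_nonneg:
  assumes "nonneg u"
  obtains r where "0 \<le> r" "scalar u = complex_of_real r"
proof -
  obtain h where h: "adj h = h" "u = h * h" using assms by (auto simp: nonneg_def)
  have "cnj (scalar h) = scalar h" using arg_cong[OF h(1), of scalar] by simp
  then have "scalar h = complex_of_real (Re (scalar h))" by (simp add: complex_eq_iff)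
  then have "scalar u = complex_of_real (Re (scalar h) * Re (scalar h))"
    unfolding h(2) scalar_simps by (metis of_real_mult)
  then show thesis by (rule that[rotated]) simp
qed

text \<open>
Let \<open>v = x x\<^sup>*\<close> and let \<open>G\<close>, \<open>m\<close> and \<open>h = 1 - m / \<alpha>\<close> come from \<open>exists_truncation\<close>. The annihilator is
the double annihilator of \<open>G\<close>. It contains \<open>G \<noteq> 0\<close>, and \<open>h\<close> acts as a unit on it: for \<open>c\<close> in it the
element \<open>(m c) (m c)\<^sup>*\<close> annihilates \<open>G\<close>, hence \<open>c\<close>, and so \<open>m c = 0\<close>. Consequently \<open>u c = u h c\<close>, while
\<open>h\<^sup>2 \<le> x x\<^sup>* / \<alpha>\<close> bounds \<open>\<parallel>u h\<parallel>\<^sup>2\<close> by \<open>\<parallel>u x\<parallel>\<^sup>2 / \<alpha>\<close>.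
\<close>

lemma small_annihilator:
  fixes x :: "'a::cstar_algebra unitization"
  assumes x: "scalar x = 0" and \<alpha>: "0 < \<alpha>" "\<alpha> < (norm x)\<^sup>2"
  shows "\<exists>S. perp S \<noteq> {0} \<and> (\<forall>u c. adj u = u \<longrightarrow> c \<in> perp S \<longrightarrow>
    (norm (u * unitize c))\<^sup>2 \<le> (norm (u * x))\<^sup>2 / \<alpha> * (norm c)\<^sup>2)"
proof -
  define v where "v = x * adj x"
  have v: "nonneg v" "norm v = (norm x)\<^sup>2"
    by (simp_all add: v_def nonneg_self_mult_adj cstar_identity')
  obtain G m where G: "nonneg G" and m: "nonneg m" and k: "v - \<alpha> *\<^sub>R 1 = G - m"
    and Gm: "G * m = 0" and G0: "G \<noteq> 0"
    and hh: "nonneg ((1 / \<alpha>) *\<^sub>R v - (1 - (1 / \<alpha>) *\<^sub>R m) * (1 - (1 / \<alpha>) *\<^sub>R m))"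
    using exists_truncation[OF v(1) \<alpha>(1)] \<alpha>(2) unfolding v(2) by metis
  define h where "h = 1 - (1 / \<alpha>) *\<^sub>R m"
  have ah: "adj h = h" by (simp add: h_def adj_diff adj_scaleR nonneg_adj[OF m])
  obtain r where r: "0 \<le> r" "scalar G = complex_of_real r" using scalar_nonneg[OF G] .
  \<comment> \<open>\<open>G\<close> and \<open>m\<close> are defined in the unitization; only \<open>G\<close> has to lie in the algebra itself.\<close>
  have "scalar G = 0"
  proof (rule ccontr)
    assume nz: "scalar G \<noteq> 0"
    have "scalar G * scalar m = 0" using arg_cong[OF Gm, of scalar] by simp
    with nz have "scalar m = 0" by simp
    then have "scalar G = complex_of_real (- \<alpha>)"
      using arg_cong[OF k, of scalar] by (simp add: v_def x)
    then have "r = - \<alpha>" using r(2) of_real_eq_iff by metis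
    with r(1) \<alpha>(1) show False by simp
  qed
  then obtain g where g: "G = unitize g" using unitize_elem by metis
  have ag: "adj g = g" using nonneg_adj[OF G] by (simp add: g unitize_adj[symmetric])
  have "g \<noteq> 0" using G0 by (auto simp: g unitize_arith)
  have mc: "m * unitize c = 0" if c: "c \<in> perp (perp {g})" for c
  proof -
    have "scalar (m * unitize c) = 0" by simp
    then obtain p where p: "m * unitize c = unitize p" using unitize_elem by metis
    have "unitize (g * p) = 0" unfolding unitize_mult g[symmetric] p[symmetric]
      by (simp add: mult.assoc[symmetric] Gm)
    then have "g * p = 0" by (metis unitize_zero unitize_eq_iff)
    then have "p * adj p \<in> perp {g}"
      by (simp add: perp_def cstar_orthogonal_def adj_mult adj_adj mult.assoc[symmetric])
    then have "p * adj p * c = 0" using c by (auto simp: perp_def cstar_orthogonal_def)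
    then have "adj (adj p * c) * (adj p * c) = 0" by (simp add: adj_mult adj_adj mult.assoc)
    then have "adj p * c = 0" using cstar_identity[of "adj p * c"] by simp
    then have "adj (unitize p) * unitize c = 0"
      by (simp add: unitize_adj[symmetric] unitize_mult[symmetric] unitize_zero)
    then have z: "adj (unitize c) * m * unitize c = 0"
      by (simp add: p[symmetric] adj_mult nonneg_adj[OF m])
    obtain l where l: "adj l = l" "m = l * l" using m by (auto simp: nonneg_def)
    have "adj (l * unitize c) * (l * unitize c) = 0" using z by (simp add: l adj_mult mult.assoc)
    then have "l * unitize c = 0" using cstar_identity[of "l * unitize c"] by simp
    then show ?thesis by (simp add: l mult.assoc)
  qed
  have bound: "(norm (u * unitize c))\<^sup>2 \<le> (norm (u * x))\<^sup>2 / \<alpha> * (norm c)\<^sup>2"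
    if u: "adj u = u" and c: "c \<in> perp (perp {g})" for u c
  proof -
    have "h * unitize c = unitize c" using mc[OF c] by (simp add: h_def algebra_simps)
    then have "norm (u * unitize c) \<le> norm (u * h) * norm c"
      using norm_mult_ineq[of "u * h" "unitize c"] by (simp add: mult.assoc)
    then have 1: "(norm (u * unitize c))\<^sup>2 \<le> (norm (u * h))\<^sup>2 * (norm c)\<^sup>2"
      by (metis norm_ge_zero power_mono power_mult_distrib)
    have "nonneg (adj u * ((1 / \<alpha>) *\<^sub>R v - h * h) * u)"
      using hh unfolding h_def by (rule nonneg_conj)
    moreover have "adj u * ((1 / \<alpha>) *\<^sub>R v - h * h) * u
        = (1 / \<alpha>) *\<^sub>R ((u * x) * adj (u * x)) - (u * h) * adj (u * h)"
      by (simp add: v_def u ah adj_mult algebra_simps)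
    ultimately have "norm ((u * h) * adj (u * h)) \<le> norm ((1 / \<alpha>) *\<^sub>R ((u * x) * adj (u * x)))"
      by (intro norm_mono nonneg_self_mult_adj) simp
    then have "(norm (u * h))\<^sup>2 \<le> (norm (u * x))\<^sup>2 / \<alpha>"
      using \<alpha>(1) by (simp add: cstar_identity')
    with 1 show ?thesis by (meson mult_right_mono order_trans zero_le_power2)
  qed
  have "perp (perp {g}) \<noteq> {0}" using in_perp_perp[OF ag] \<open>g \<noteq> 0\<close> by blast
  with bound show ?thesis by blast
qed

theorem theorem3p25:
  fixes B :: "'a::cstar_algebra set"
  assumes "cstar_subalgebra B"
    and "separation B < 1"
  shows "separation B = 0"
proof -
  have B: "closed_subalgebra B" by (rule closed_subalgebra_cstar_subalgebra[OF assms(1)])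
  have B0: "0 \<in> B" using assms(1) by (simp add: cstar_subalgebra_def)
  have perp0: "0 \<in> perp S" for S :: "'a set"
    by (simp add: perp_def cstar_orthogonal_def)
  obtain S where S: "perp S \<noteq> {0}" and less: "prod_norm B (perp S) < 1"
    using assms(2) unfolding separation_def annihilators_def INF_less_iff by auto
  define \<tau> where "\<tau> = prod_norm B (perp S)"
  have "0 \<le> \<tau>" unfolding \<tau>_def by (rule prod_norm_nonneg[OF B0 perp0])
  have small: "\<exists>S'. perp S' \<noteq> {0} \<and> prod_norm B (perp S') \<le> \<epsilon>" if "\<epsilon> > 0" for \<epsilon>
  proof (cases "\<tau> = 0")
    case True
    with S \<open>\<epsilon> > 0\<close> show ?thesis unfolding \<tau>_def by (intro exI[of _ S]) simp
  next
    case False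
    with \<open>0 \<le> \<tau>\<close> less have \<tau>: "0 < \<tau>" "\<tau> < 1" by (simp_all add: \<tau>_def)
    have \<tau>2: "0 < \<tau>\<^sup>2" "\<tau>\<^sup>2 < 1" using \<tau> by (simp_all add: power_less_one_iff abs_square_less_1)
    \<comment> \<open>As \<open>T > \<tau>\<^sup>2 / 2\<close> below, \<open>\<parallel>x\<parallel>\<^sup>2\<close> will be at least \<open>(1 - \<tau>\<^sup>2) / 2\<close>; \<open>\<alpha>\<close> is half of that.\<close>
    define \<alpha> where "\<alpha> = (1 - \<tau>\<^sup>2) / 4"
    have \<alpha>: "\<alpha> > 0" using \<tau>2 by (simp add: \<alpha>_def)
    \<comment> \<open>The second term, with the choice of \<open>n\<close>, makes \<open>\<parallel>u x\<parallel>\<^sup>2\<close> at most \<open>\<epsilon>\<^sup>2 \<alpha>\<close>.\<close>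
    define \<eta> where "\<eta> = min (\<tau>\<^sup>2 / 2) (\<epsilon>\<^sup>2 * \<alpha> / 2)"
    have \<eta>: "\<eta> > 0" "\<eta> \<le> \<tau>\<^sup>2 / 2" "\<eta> \<le> \<epsilon>\<^sup>2 * \<alpha> / 2"
      using \<tau>2 \<alpha> \<open>\<epsilon> > 0\<close> by (simp_all add: \<eta>_def)
    have "sqrt (\<tau>\<^sup>2 - \<eta>) < sqrt (\<tau>\<^sup>2)" using \<eta>(1) by (subst real_sqrt_less_iff) simp
    then have "sqrt (\<tau>\<^sup>2 - \<eta>) < \<tau>" using \<tau> by simp
    then obtain b d where b: "b \<in> pos_unit_ball B" and d: "d \<in> pos_unit_ball (perp S)"
      and bd: "sqrt (\<tau>\<^sup>2 - \<eta>) < norm (b * d)"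
      using less_prod_norm[OF B0 perp0] unfolding \<tau>_def by blast
    define T where "T = (norm (b * d))\<^sup>2"
    have T\<eta>: "\<tau>\<^sup>2 - \<eta> < T" unfolding T_def using bd \<tau>2 \<eta>
      by (metis less_eq_real_def not_le real_le_rsqrt real_sqrt_le_iff real_sqrt_abs abs_norm_cancel
          linorder_not_less order.strict_trans1)
    then have T2: "\<tau>\<^sup>2 / 2 < T" using \<eta>(2) by simp
    then have T0: "T > 0" using \<tau>2(1) by linarith
    obtain n :: nat where n: "1 / (\<epsilon>\<^sup>2 * \<alpha> / 2) < real n" using reals_Archimedean2 by blast
    have n2: "1 / (real (2 * n) + 1) \<le> \<epsilon>\<^sup>2 * \<alpha> / 2"
    proof -
      have p: "\<epsilon>\<^sup>2 * \<alpha> / 2 > 0" using \<alpha> \<open>\<epsilon> > 0\<close> by simp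
      with n have "1 < real n * (\<epsilon>\<^sup>2 * \<alpha> / 2)" by (simp only: pos_divide_less_eq)
      also have "\<dots> \<le> (real (2 * n) + 1) * (\<epsilon>\<^sup>2 * \<alpha> / 2)" using p by (intro mult_right_mono) auto
      finally show ?thesis by (simp add: pos_divide_le_eq mult.commute)
    qed
    have hered: "x * z * y \<in> unitize ` perp S" if "x \<in> unitize ` perp S" "y \<in> unitize ` perp S" for x y z
    proof -
      obtain x' y' where xy: "x = unitize x'" "y = unitize y'" "x' \<in> perp S" "y' \<in> perp S"
        using \<open>x \<in> unitize ` perp S\<close> \<open>y \<in> unitize ` perp S\<close> by blast
      have "x * z * y = unitize (x' * elem z * y' + scalar z *\<^sub>C (x' * y'))"
        by (rule unitization_eqI) (simp_all add: xy algebra_simps mult_scaleC_left mult_scaleC_right)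
      moreover have "x' * elem z * y' + scalar z *\<^sub>C (x' * y') \<in> perp S"
        using perp_hereditary[OF xy(3,4)]
        by (simp add: perp_def cstar_orthogonal_def distrib_left mult_scaleC_right adj_add adj_scaleC)
      ultimately show ?thesis by blast
    qed
    have H: "norm (r * y) \<le> \<tau> * norm y"
      if rB: "r \<in> unitize ` B" "nonneg r" "norm r \<le> 1" and yD: "y \<in> unitize ` perp S" for r y
    proof -
      obtain r' y' where ry: "r = unitize r'" "y = unitize y'" "r' \<in> B" "y' \<in> perp S"
        using rB(1) yD by blast
      with rB have "r' \<in> pos_unit_ball B"
        by (simp add: pos_unit_ball_def cstar_positive_of_nonneg)
      from norm_mult_le_prod_norm[OF this ry(4)] show ?thesis
        by (simp add: ry(1,2) \<tau>_def unitize_mult[symmetric])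
    qed
    have be: "unitize b \<in> unitize ` B" "adj (unitize b) = unitize b" "norm (unitize b) \<le> 1"
      using b adj_pos_unit_ball[OF b] norm_pos_unit_ball[OF b]
      by (simp_all add: unitize_adj[symmetric] pos_unit_ball_def)
    have de: "unitize d \<in> unitize ` perp S" "adj (unitize d) = unitize d" "norm (unitize d) \<le> 1"
      using d adj_pos_unit_ball[OF d] norm_pos_unit_ball[OF d]
      by (simp_all add: unitize_adj[symmetric] pos_unit_ball_def)
    have Te: "T = (norm (unitize b * unitize d))\<^sup>2" by (simp add: T_def unitize_mult[symmetric])
    obtain s g where low: "T * (1 - \<tau>\<^sup>2) / \<tau>\<^sup>2 \<le> (norm (s * unitize d * g))\<^sup>2"
      and up: "\<forall>u\<in>unitize ` B. adj u = u \<longrightarrow> norm u \<le> 1 \<longrightarrow>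
        (norm (u * (s * unitize d * g)))\<^sup>2 \<le> (\<tau>\<^sup>2 - T) + 1 / (real (2 * n) + 1)"
      using exists_almost_orthogonal[OF closed_subalgebra_unitize[OF B] closed_subalgebra_unitize[OF closed_subalgebra_perp]
        hered \<tau> H be de Te T0, of n] by blast
    define x where "x = s * unitize d * g"
    have "(1 - \<tau>\<^sup>2) / 2 = (\<tau>\<^sup>2 / 2) * (1 - \<tau>\<^sup>2) / \<tau>\<^sup>2" using \<tau>2 by simp
    also have "\<dots> \<le> T * (1 - \<tau>\<^sup>2) / \<tau>\<^sup>2"
      using T2 \<tau>2 by (intro divide_right_mono mult_right_mono) auto
    also have "\<dots> \<le> (norm x)\<^sup>2" using low by (simp only: x_def)
    finally have "(1 - \<tau>\<^sup>2) / 2 \<le> (norm x)\<^sup>2" .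
    then have "\<alpha> < (norm x)\<^sup>2" using \<tau>2 by (simp add: \<alpha>_def)
    moreover have "scalar x = 0" by (simp add: x_def)
    ultimately obtain S' where S': "perp S' \<noteq> {0}"
      and bound: "\<forall>u c. adj u = u \<longrightarrow> c \<in> perp S' \<longrightarrow>
        (norm (u * unitize c))\<^sup>2 \<le> (norm (u * x))\<^sup>2 / \<alpha> * (norm c)\<^sup>2"
      using small_annihilator[OF _ \<alpha>] by blast
    have "prod_norm B (perp S') \<le> \<epsilon>"
    proof (rule prod_norm_le[OF B0 perp0])
      fix u c assume u: "u \<in> pos_unit_ball B" and c: "c \<in> pos_unit_ball (perp S')"
      have ue: "unitize u \<in> unitize ` B" "adj (unitize u) = unitize u" "norm (unitize u) \<le> 1"
        using u adj_pos_unit_ball[OF u] norm_pos_unit_ball[OF u]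
        by (simp_all add: unitize_adj[symmetric] pos_unit_ball_def)
      have "(norm (unitize u * x))\<^sup>2 \<le> (\<tau>\<^sup>2 - T) + 1 / (real (2 * n) + 1)"
        unfolding x_def using up ue by blast
      also have "\<dots> \<le> \<epsilon>\<^sup>2 * \<alpha>" using T\<eta> \<eta>(3) n2 by linarith
      finally have ux: "(norm (unitize u * x))\<^sup>2 / \<alpha> \<le> \<epsilon>\<^sup>2" using \<alpha> by (simp add: pos_divide_le_eq)
      have "(norm (u * c))\<^sup>2 = (norm (unitize u * unitize c))\<^sup>2" by (simp add: unitize_mult[symmetric])
      also have "\<dots> \<le> (norm (unitize u * x))\<^sup>2 / \<alpha> * (norm c)\<^sup>2"
        using bound ue(2) c by (simp add: pos_unit_ball_def)
      also have "\<dots> \<le> \<epsilon>\<^sup>2 * 1"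
        using ux norm_pos_unit_ball[OF c] by (intro mult_mono) (auto simp: power_le_one)
      finally show "norm (u * c) \<le> \<epsilon>" using \<open>\<epsilon> > 0\<close> by (simp add: power2_le_iff_abs_le)
    qed
    with S' show ?thesis by blast
  qed
  have "separation B \<le> 0 + ereal \<epsilon>" if "\<epsilon> > 0" for \<epsilon>
  proof -
    obtain S' where "perp S' \<noteq> {0}" "prod_norm B (perp S') \<le> \<epsilon>" using small[OF \<open>\<epsilon> > 0\<close>] by blast
    then show ?thesis unfolding separation_def annihilators_def
      by (intro INF_lower2[of "perp S'"]) auto
  qed
  then have "separation B \<le> 0" by (rule ereal_le_epsilon2)
  moreover have "0 \<le> separation B"
    unfolding separation_def annihilators_def
    by (rule INF_greatest) (use prod_norm_nonneg[OF B0 perp0] in auto)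
  ultimately show ?thesis by simp
qed

end
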